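(* Let $1\leqslant r\leqslant k$ be integers and let $\eta\in[0,3^{-r+1}]$. There exist constants $C,c>0$ depending only on $k$ such that the following holds. Let $\mathcal{H}$ be a $k$-uniform hypergraph on $[N]$ which is $(r-1,\eta)$-near-regular and has maximum $r$-degree $\Delta_r$, and let $1\leqslant m\leqslant N$. Then \[ \mathbb{P}\big(|D^{\mathcal{H}}(B_m)|>a\big)\;\leqslant\; N^{C}\exp\left(\frac{-c\, a^{2/r}}{m\,\Delta_r^{2/r}}\right) \] for all $a>0$ if $r=1$, and, if $r\geqslant 2$, for all \[ a\;\geqslant\;(10\,k!)^{10^r}\,e(\mathcal{H})\left(\frac{\eta\, m^{k-1}}{N^{k-1}}\right)^{r/(r-1)}. \]
   Context: A $k$-uniform hypergraph $\mathcal{H}$ on $[N]=\{1,\dots,N\}$ is a set of $k$-element subsets (edges) of $[N]$; $e(\mathcal{H})$ is its number of edges. For $S\subseteq[N]$ let $d(S)$ be the number of edges containing $S$. The maximum $r$-degree $\Delta_r$ is the maximum of $d(S)$ over $r$-element sets $S$. The average $r$-degree is $\bar d_r=e(\mathcal{H})\binom{k}{r}/\binom{N}{r}$. $\mathcal{H}$ is $(r,\eta)$-near-regular if every $r$-element $S\subseteq[N]$ has $(1-\eta)\bar d_r\leqslant d(S)\leqslant(1+\eta)\bar d_r$ (every hypergraph is $(0,\eta)$-near-regular). $B_m$ denotes a uniformly random $m$-element subset of $[N]$. $N^{\mathcal{H}}(B)$ is the number of edges of $\mathcal{H}$ contained in $B$, $L^{\mathcal{H}}(m)=\mathbb{E}[N^{\mathcal{H}}(B_m)]$,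 and $D^{\mathcal{H}}(B_m)=N^{\mathcal{H}}(B_m)-L^{\mathcal{H}}(m)$. *)

theory Defs
  imports "HOL-Probability.Probability" "HOL-Library.Ramsey"
begin

definition uniform_hypergraph :: "nat \<Rightarrow> nat \<Rightarrow> nat set set \<Rightarrow> bool" where
  "uniform_hypergraph k N H \<longleftrightarrow> H \<subseteq> nsets {1..N} k"

definition hdeg :: "nat set set \<Rightarrow> nat set \<Rightarrow> nat" where
  "hdeg H S = card {e \<in> H. S \<subseteq> e}"

text \<open>The supremum on \<^typ>\<open>nat\<close> is the maximum of a finite nonempty set, and is \<open>0\<close> on the empty set
  (which occurs here only when \<open>r > N\<close>).\<close>

definition max_degree :: "nat \<Rightarrow> nat \<Rightarrow> nat set set \<Rightarrow> nat" where
  "max_degree r N H = (SUP S \<in> nsets {1..N} r. hdeg H S)"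

definition avg_degree :: "nat \<Rightarrow> nat \<Rightarrow> nat \<Rightarrow> nat set set \<Rightarrow> real" where
  "avg_degree r k N H = real (card H) * real (k choose r) / real (N choose r)"

definition near_regular :: "nat \<Rightarrow> real \<Rightarrow> nat \<Rightarrow> nat \<Rightarrow> nat set set \<Rightarrow> bool" where
  "near_regular r \<eta> k N H \<longleftrightarrow>
    (\<forall>S \<in> nsets {1..N} r.
       (1 - \<eta>) * avg_degree r k N H \<le> real (hdeg H S) \<and>
       real (hdeg H S) \<le> (1 + \<eta>) * avg_degree r k N H)"

definition random_subset :: "nat \<Rightarrow> nat \<Rightarrow> nat set pmf" where
  "random_subset N m = pmf_of_set (nsets {1..N} m)"

definition edge_count :: "nat set set \<Rightarrow> nat set \<Rightarrow> nat" where
  "edge_count H B = card {e \<in> H. e \<subseteq> B}"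

definition mean_edge_count :: "nat \<Rightarrow> nat set set \<Rightarrow> nat \<Rightarrow> real" where
  "mean_edge_count N H m =
    measure_pmf.expectation (random_subset N m) (\<lambda>B. real (edge_count H B))"

definition deviation :: "nat \<Rightarrow> nat set set \<Rightarrow> nat \<Rightarrow> nat set \<Rightarrow> real" where
  "deviation N H m B = real (edge_count H B) - mean_edge_count N H m"

end

theory Submission imports Defs begin

text \<open>
  The tail bound follows from Markov's inequality for even moments of order \<open>2 q\<close>, where
  \<open>q\<close> is of order \<open>(a / \<Delta>) powr (2 / r) / m\<close>.

  Expose the elements of the random set one at a time. Each exposure step adds a martingale
  increment; symmetrising it and comparing binomial coefficients shows that the \<open>2 q\<close>-th moment of a
  centred function \<open>f\<close> of the random set is at most \<open>(24 q m) ^ q\<close> times the average \<open>2 q\<close>-th moment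
  of the change of \<open>f\<close> when one element \<open>x\<close> is swapped for another element \<open>y\<close>.

  For the edge count this change is the difference between the edge counts of the links of \<open>x\<close> and \<open>y\<close>,
  evaluated on a random set of size \<open>m - 1\<close>. The links have uniformity \<open>k - 1\<close>, so one recurses \<open>r\<close> times,
  losing a factor \<open>s\<close> with \<open>s\<^sup>2 = 216 q m\<close> each time. The difference of the means of
  the two links is controlled at depth \<open>j < r\<close> by near-regularity and at depth \<open>r\<close> by \<open>\<Delta>\<close>. The lower
  bound on \<open>a\<close> says precisely that the near-regularity error at depth \<open>1\<close> is negligible; the errors
  at larger depths are then negligible as well.
\<close>

subsection \<open>Inequalities for powers\<close>

text \<open>Half the sum \<open>a\<close> and half the difference \<open>b\<close> of the two powers
  satisfy coupled linear recursions. Since \<open>x * z * b q\<close> is at most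
  \<open>2 * q * z\<^sup>2 * a q\<close>, one step multiplies \<open>a\<close> by at most
  \<open>x\<^sup>2 + (4 * q + 1) * z\<^sup>2\<close>. The coefficient of \<open>x\<^sup>2\<close>
  stays 1, so the bound can be iterated over many exposure steps.\<close>

lemma symmetric_two_point_power_le:
  fixes x z :: real
  shows "((x + z) ^ (2 * q) + (x - z) ^ (2 * q)) / 2 \<le> (x\<^sup>2 + 4 * real q * z\<^sup>2) ^ q"
proof -
  define a where "a = (\<lambda>q. ((x + z) ^ (2 * q) + (x - z) ^ (2 * q)) / 2)"
  define b where "b = (\<lambda>q. ((x + z) ^ (2 * q) - (x - z) ^ (2 * q)) / 2)"
  have a_Suc: "a (Suc q) = (x\<^sup>2 + z\<^sup>2) * a q + 2 * (x * z * b q)" for q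
    by (simp add: a_def b_def power2_eq_square field_simps)
  have b_Suc: "b (Suc q) = (x\<^sup>2 + z\<^sup>2) * b q + 2 * (x * z * a q)" for q
    by (simp add: a_def b_def power2_eq_square field_simps)
  have a_nonneg: "0 \<le> a q" for q
    unfolding a_def by (simp add: power_mult)
  have xzb: "0 \<le> x * z * b q \<and> x * z * b q \<le> 2 * real q * z\<^sup>2 * a q" for q
  proof (induction q)
    case 0
    show ?case by (simp add: a_def b_def)
  next
    case (Suc q)
    have eq: "x * z * b (Suc q) = (x\<^sup>2 + z\<^sup>2) * (x * z * b q) + 2 * (x\<^sup>2 * z\<^sup>2 * a q)"
      by (simp add: b_Suc power2_eq_square algebra_simps)
    have "x * z * b (Suc q) \<le> (x\<^sup>2 + z\<^sup>2) * (2 * real q * z\<^sup>2 * a q) + 2 * (x\<^sup>2 * z\<^sup>2 * a q)"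
      unfolding eq using Suc by (intro add_mono mult_left_mono) auto
    also have "\<dots> \<le> 2 * real (Suc q) * z\<^sup>2 * ((x\<^sup>2 + z\<^sup>2) * a q)"
    proof -
      have "0 \<le> z\<^sup>2 * z\<^sup>2 * a q" using a_nonneg by simp
      then show ?thesis by (simp add: algebra_simps)
    qed
    also have "\<dots> \<le> 2 * real (Suc q) * z\<^sup>2 * a (Suc q)"
      using Suc by (intro mult_left_mono) (auto simp: a_Suc)
    finally show ?case
      unfolding eq using Suc a_nonneg[of q] by (auto intro!: add_nonneg_nonneg mult_nonneg_nonneg)
  qed
  \<comment> \<open>The base must not change during the induction, so its parameter \<open>p\<close>
    is separated from the exponent; \<open>4 * q + 1 \<le> 4 * p\<close> holds whenever
    \<open>Suc q \<le> p\<close>.\<close>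
  have "a q \<le> (x\<^sup>2 + 4 * real p * z\<^sup>2) ^ q" if "q \<le> p" for p
    using that
  proof (induction q)
    case 0
    show ?case by (simp add: a_def)
  next
    case (Suc q)
    have "a (Suc q) \<le> (x\<^sup>2 + z\<^sup>2) * a q + 2 * (2 * real q * z\<^sup>2 * a q)"
      unfolding a_Suc using xzb[of q] by linarith
    also have "\<dots> = (x\<^sup>2 + (4 * real q + 1) * z\<^sup>2) * a q"
      by (simp add: algebra_simps)
    also have "\<dots> \<le> (x\<^sup>2 + 4 * real p * z\<^sup>2) * (x\<^sup>2 + 4 * real p * z\<^sup>2) ^ q"
      using Suc a_nonneg by (intro mult_mono add_mono mult_right_mono) auto
    finally show ?case by simp
  qed
  then show ?thesis by (auto simp: a_def)
qed

lemma convex_power_nonneg: "convex_on {0::real..} (\<lambda>x. x ^ n)"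
  by (cases "even n")
     (auto intro: convex_power_odd convex_on_subset[OF convex_power_even])

text \<open>Convexity with the unequal weights \<open>M / (M + 1)\<close> and
  \<open>1 / (M + 1)\<close>. The factor of \<open>a ^ q\<close> is so close to 1 that
  \<open>M\<close> repetitions cost at most \<open>exp 1 ^ q\<close>; the price is the larger factor
  of \<open>b ^ q\<close>.\<close>

lemma power_add_le_weighted:
  fixes a b :: real
  assumes "0 \<le> a" "0 \<le> b" "0 < M" "0 < q"
  shows "(a + b) ^ q \<le> (1 + 1 / real M) ^ q * a ^ q + (real M + 1) ^ (q - 1) * b ^ q"
proof -
  let ?t = "1 / (real M + 1)"
  have "(a + b) ^ q = ((1 - ?t) *\<^sub>R ((1 + 1 / real M) * a) + ?t *\<^sub>R ((real M + 1) * b)) ^ q"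
  proof -
    have "(1 - ?t) * (1 + 1 / real M) = 1"
      using assms by (simp add: add_divide_eq_iff diff_divide_eq_iff add_nonneg_eq_0_iff)
    then have "(1 - ?t) * ((1 + 1 / real M) * a) = a"
      by (simp only: mult.assoc[symmetric] mult_1_left)
    moreover have "?t * ((real M + 1) * b) = b"
      by simp
    ultimately show ?thesis by (simp only: real_scaleR_def)
  qed
  also have "\<dots> \<le> (1 - ?t) * ((1 + 1 / real M) * a) ^ q + ?t * ((real M + 1) * b) ^ q"
    using assms by (intro convex_onD[OF convex_power_nonneg]) auto
  also have "?t * ((real M + 1) * b) ^ q = (real M + 1) ^ (q - 1) * b ^ q"
    using assms by (cases q) (auto simp: power_mult_distrib)
  also have "(1 - ?t) * ((1 + 1 / real M) * a) ^ q \<le> 1 * ((1 + 1 / real M) * a) ^ q"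
    using assms by (intro mult_right_mono) auto
  finally show ?thesis by (simp add: power_mult_distrib)
qed

subsection \<open>Averages over finite sets\<close>

text \<open>Over an empty set the value is 0. This convention settles the boundary cases below in
  which no subset of the required size exists.\<close>

definition average :: "'a set \<Rightarrow> ('a \<Rightarrow> real) \<Rightarrow> real" where
  "average A f = (\<Sum>a\<in>A. f a) / real (card A)"

lemma average_mono: "(\<And>a. a \<in> A \<Longrightarrow> f a \<le> g a) \<Longrightarrow> average A f \<le> average A g"
  unfolding average_def by (intro divide_right_mono sum_mono) auto

lemma average_cong: "(\<And>a. a \<in> A \<Longrightarrow> f a = g a) \<Longrightarrow> average A f = average A g"
  unfolding average_def by (auto cong: sum.cong)

lemma average_add: "average A (\<lambda>a. f a + g a) = average A f + average A g"
  by (simp add: average_def sum.distrib add_divide_distrib)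

lemma average_diff: "average A (\<lambda>a. f a - g a) = average A f - average A g"
  by (simp add: average_def sum_subtractf diff_divide_distrib)

lemma average_cmult: "average A (\<lambda>a. c * f a) = c * average A f"
  by (simp add: average_def sum_distrib_left)

lemma average_const: "finite A \<Longrightarrow> A \<noteq> {} \<Longrightarrow> average A (\<lambda>a. c) = c"
  by (simp add: average_def)

lemma average_nonneg: "(\<And>a. a \<in> A \<Longrightarrow> 0 \<le> f a) \<Longrightarrow> 0 \<le> average A f"
  unfolding average_def by (intro divide_nonneg_nonneg sum_nonneg) auto

lemma sum_eq_average: "finite A \<Longrightarrow> (\<Sum>a\<in>A. f a) = real (card A) * average A f"
  by (cases "A = {}") (auto simp: average_def)

lemma average_swap:
  "average A (\<lambda>x. average B (\<lambda>y. f x y)) = average B (\<lambda>y. average A (\<lambda>x. f x y))"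
proof -
  have "(\<Sum>x\<in>A. \<Sum>y\<in>B. f x y) = (\<Sum>y\<in>B. \<Sum>x\<in>A. f x y)"
    by (rule sum.swap)
  then show ?thesis
    by (simp add: average_def sum_divide_distrib[symmetric] mult.commute)
qed

lemma average_power_le:
  assumes "finite A" "A \<noteq> {}" "even n"
  shows "average A f ^ n \<le> average A (\<lambda>a. f a ^ n)"
  using convex_on_sum[OF assms(1,2) convex_power_even[OF assms(3)], of "\<lambda>_. 1 / card A" f] assms
  by (simp add: average_def sum_divide_distrib)

text \<open>By Jensen's inequality the fluctuation of \<open>f x\<close> around its mean may be replaced by \<open>f x - f y\<close>,
  whose distribution is symmetric, so that only even powers survive.\<close>

lemma average_power_le_symmetrized:
  assumes "finite A" "A \<noteq> {}" "0 < q" "0 < M"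
  shows "average A (\<lambda>x. f x ^ (2 * q)) \<le>
    (1 + 1 / real M) ^ q * average A f ^ (2 * q) +
    (real M + 1) ^ (q - 1) * (4 * real q) ^ q *
      average A (\<lambda>x. average A (\<lambda>y. (f x - f y) ^ (2 * q)))"
proof -
  define t where "t = average A f"
  have plus: "average A (\<lambda>x. f x ^ (2 * q)) \<le>
      average A (\<lambda>x. average A (\<lambda>y. (t + (f x - f y)) ^ (2 * q)))"
  proof (intro average_mono)
    fix x assume "x \<in> A"
    have "f x = average A (\<lambda>y. t + (f x - f y))"
      using assms by (simp add: average_add average_diff average_const t_def)
    then show "f x ^ (2 * q) \<le> average A (\<lambda>y. (t + (f x - f y)) ^ (2 * q))"
      using average_power_le[OF assms(1,2), of "2 * q" "\<lambda>y. t + (f x - f y)"] by simp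
  qed
  \<comment> \<open>Exchanging \<open>x\<close> and \<open>y\<close> flips the sign of the
    difference. The mean of the two resulting bounds has the shape of the two-point
    inequality.\<close>
  also have "average A (\<lambda>x. average A (\<lambda>y. (t + (f x - f y)) ^ (2 * q))) =
      average A (\<lambda>x. average A (\<lambda>y. (t - (f x - f y)) ^ (2 * q)))"
    by (subst average_swap) (simp add: algebra_simps)
  finally have minus: "average A (\<lambda>x. f x ^ (2 * q)) \<le>
      average A (\<lambda>x. average A (\<lambda>y. (t - (f x - f y)) ^ (2 * q)))" .
  have half: "u \<le> 1/2 * (v + w)" if "u \<le> v" "u \<le> w" for u v w :: real
    using that by simp
  note half[OF plus minus]
  also have "1/2 * (average A (\<lambda>x. average A (\<lambda>y. (t + (f x - f y)) ^ (2 * q)))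
        + average A (\<lambda>x. average A (\<lambda>y. (t - (f x - f y)) ^ (2 * q)))) = average A (\<lambda>x. average A (\<lambda>y.
      1/2 * ((t + (f x - f y)) ^ (2 * q) + (t - (f x - f y)) ^ (2 * q))))"
    unfolding average_add[symmetric] average_cmult[symmetric] ..
  also have "\<dots> \<le> average A (\<lambda>x. average A (\<lambda>y. (1 + 1 / real M) ^ q * t ^ (2 * q) +
      (real M + 1) ^ (q - 1) * (4 * real q) ^ q * (f x - f y) ^ (2 * q)))"
  proof (intro average_mono)
    fix x y
    have "1/2 * ((t + (f x - f y)) ^ (2 * q) + (t - (f x - f y)) ^ (2 * q))
        \<le> (t\<^sup>2 + 4 * real q * (f x - f y)\<^sup>2) ^ q"
      using symmetric_two_point_power_le[of t "f x - f y" q] by simp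
    also have "\<dots> \<le> (1 + 1 / real M) ^ q * (t\<^sup>2) ^ q +
        (real M + 1) ^ (q - 1) * (4 * real q * (f x - f y)\<^sup>2) ^ q"
      using assms by (intro power_add_le_weighted) auto
    finally show "1/2 * ((t + (f x - f y)) ^ (2 * q) + (t - (f x - f y)) ^ (2 * q)) \<le>
       (1 + 1 / real M) ^ q * t ^ (2 * q) +
       (real M + 1) ^ (q - 1) * (4 * real q) ^ q * (f x - f y) ^ (2 * q)"
      by (simp add: power_mult power_mult_distrib mult.assoc)
  qed
  also have "\<dots> = (1 + 1 / real M) ^ q * t ^ (2 * q) + (real M + 1) ^ (q - 1) * (4 * real q) ^ q *
      average A (\<lambda>x. average A (\<lambda>y. (f x - f y) ^ (2 * q)))"
    using assms by (simp only: average_add average_cmult average_const not_False_eq_True)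
  finally show ?thesis by (simp add: t_def)
qed

subsection \<open>Double counting of fixed-size subsets\<close>

lemma nsets_Suc_diff: "B \<in> nsets V (Suc m) \<Longrightarrow> x \<in> B \<Longrightarrow> B - {x} \<in> nsets V m"
  by (auto simp: nsets_def)

lemma nsets_insert: "A \<in> nsets V m \<Longrightarrow> x \<in> V - A \<Longrightarrow> insert x A \<in> nsets V (Suc m)"
  by (auto simp: nsets_def)

text \<open>The pairs \<open>(A, x)\<close> with \<open>x\<close> outside \<open>A\<close>
  correspond to the pairs \<open>(B, x)\<close> with \<open>x\<close> in \<open>B\<close>, through
  \<open>B = insert x A\<close>.\<close>

lemma sum_nsets_Suc:
  assumes "finite V"
  shows "(\<Sum>A\<in>nsets V m. \<Sum>x\<in>V - A. g A x) = (\<Sum>B\<in>nsets V (Suc m). \<Sum>x\<in>B. g (B - {x}) x)"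
proof -
  have fin: "finite (nsets V m)" "finite (nsets V (Suc m))" for m
    using assms by (auto intro: finite_imp_finite_nsets)
  have "(\<Sum>A\<in>nsets V m. \<Sum>x\<in>V - A. g A x) = (\<Sum>(A, x)\<in>Sigma (nsets V m) (\<lambda>A. V - A). g A x)"
    using fin assms by (subst sum.Sigma) auto
  also have "\<dots> = (\<Sum>(B, x)\<in>Sigma (nsets V (Suc m)) (\<lambda>B. B). g (B - {x}) x)"
    by (rule sum.reindex_bij_witness[of _ "\<lambda>(B, x). (B - {x}, x)" "\<lambda>(A, x). (insert x A, x)"])
       (auto intro: nsets_Suc_diff nsets_insert simp: insert_absorb,
        auto simp: nsets_def)
  also have "\<dots> = (\<Sum>B\<in>nsets V (Suc m). \<Sum>x\<in>B. g (B - {x}) x)"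
    using fin by (subst sum.Sigma) (auto simp: nsets_def)
  finally show ?thesis .
qed

lemma sum_nsets_swap:
  assumes "finite V"
  shows "(\<Sum>A\<in>nsets V m. \<Sum>x\<in>V - A. g A x) = (\<Sum>x\<in>V. \<Sum>A\<in>nsets (V - {x}) m. g A x)"
proof -
  have "(\<Sum>A\<in>nsets V m. \<Sum>x\<in>V - A. g A x) = (\<Sum>A\<in>nsets V m. \<Sum>x | x \<in> V \<and> x \<notin> A. g A x)"
    by (intro sum.cong refl) auto
  also have "\<dots> = (\<Sum>x\<in>V. \<Sum>A | A \<in> nsets V m \<and> x \<notin> A. g A x)"
    using assms by (intro sum.swap_restrict finite_imp_finite_nsets)
  also have "\<dots> = (\<Sum>x\<in>V. \<Sum>A\<in>nsets (V - {x}) m. g A x)"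
    by (intro sum.cong refl) (auto simp: nsets_def)
  finally show ?thesis .
qed

lemma sum_nsets_swap_pairs:
  assumes "finite V"
  shows "(\<Sum>A\<in>nsets V m. \<Sum>x\<in>V - A. \<Sum>y\<in>V - A - {x}. g A x y) =
    (\<Sum>x\<in>V. \<Sum>y\<in>V - {x}. \<Sum>A\<in>nsets (V - {x, y}) m. g A x y)"
proof -
  have "V - A - {x} = V - {x} - A" for A x
    by auto
  then have "(\<Sum>A\<in>nsets V m. \<Sum>x\<in>V - A. \<Sum>y\<in>V - A - {x}. g A x y) =
      (\<Sum>A\<in>nsets V m. \<Sum>x\<in>V - A. \<Sum>y\<in>V - {x} - A. g A x y)"
    by simp
  also have "\<dots> = (\<Sum>x\<in>V. \<Sum>A\<in>nsets (V - {x}) m. \<Sum>y\<in>V - {x} - A. g A x y)"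
    by (rule sum_nsets_swap[OF assms])
  also have "\<dots> = (\<Sum>x\<in>V. \<Sum>y\<in>V - {x}. \<Sum>A\<in>nsets (V - {x} - {y}) m. g A x y)"
    using assms by (intro sum.cong refl sum_nsets_swap) auto
  also have "\<dots> = (\<Sum>x\<in>V. \<Sum>y\<in>V - {x}. \<Sum>A\<in>nsets (V - {x, y}) m. g A x y)"
    by (simp only: Diff_insert2[symmetric])
  finally show ?thesis .
qed

text \<open>Adding a uniform outside element to a uniform \<open>m\<close>-set gives a uniform set
  of size \<open>Suc m\<close>: each such set arises \<open>Suc m\<close> times, and the
  normalisations agree by binomial absorption.\<close>

lemma average_nsets_Suc:
  assumes "finite V" "m < card V"
  shows "average (nsets V (Suc m)) f =
    average (nsets V m) (\<lambda>A. average (V - A) (\<lambda>x. f (insert x A)))"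
proof -
  have card_diff: "card (V - A) = card V - m" if "A \<in> nsets V m" for A
    using that assms by (auto simp: nsets_def card_Diff_subset)
  have "(\<Sum>A\<in>nsets V m. \<Sum>x\<in>V - A. f (insert x A)) = (\<Sum>B\<in>nsets V (Suc m). \<Sum>x\<in>B. f B)"
    using assms by (subst sum_nsets_Suc) (auto simp: insert_absorb intro!: sum.cong)
  also have "\<dots> = real (Suc m) * (\<Sum>B\<in>nsets V (Suc m). f B)"
    by (auto simp: nsets_def sum_distrib_left intro!: sum.cong)
  finally have sums: "(\<Sum>A\<in>nsets V m. \<Sum>x\<in>V - A. f (insert x A)) =
    real (Suc m) * (\<Sum>B\<in>nsets V (Suc m). f B)" .
  have "Suc m * (card V choose Suc m) = (card V - m) * (card V choose m)"
    using assms binomial_absorption[of m "card V"] binomial_absorb_comp[of "card V" m] by simp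
  then have bin: "real (Suc m) * real (card V choose Suc m) = real (card V - m) * real (card V choose m)"
    by (metis of_nat_mult)
  have pos: "real (card V choose Suc m) > 0" "real (card V choose m) > 0" "real (card V - m) > 0"
    using assms by auto
  have "average (nsets V m) (\<lambda>A. average (V - A) (\<lambda>x. f (insert x A))) =
      (\<Sum>A\<in>nsets V m. (\<Sum>x\<in>V - A. f (insert x A)) / real (card V - m)) / real (card V choose m)"
    unfolding average_def by (auto simp: card_diff intro!: arg_cong2[where f="(/)"] sum.cong)
  also have "\<dots> = real (Suc m) * (\<Sum>B\<in>nsets V (Suc m). f B) / (real (card V - m) * real (card V choose m))"
    by (simp add: sum_divide_distrib[symmetric] sums)
  also have "\<dots> = average (nsets V (Suc m)) f"
    unfolding bin[symmetric] using pos by (simp add: average_def)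
  finally show ?thesis by simp
qed

subsection \<open>Moments of functions on fixed-size subsets\<close>

text \<open>The conditional expectation of \<open>f\<close> given all but the last exposed element.\<close>

definition exposure_mean :: "'a set \<Rightarrow> ('a set \<Rightarrow> real) \<Rightarrow> 'a set \<Rightarrow> real" where
  "exposure_mean V f A = average (V - A) (\<lambda>x. f (insert x A))"

text \<open>The sum over ordered pairs is left unnormalised; there are
  \<open>card V * (card V - 1)\<close> of them. Here \<open>m\<close> is the size of the common
  part, so \<open>f\<close> is evaluated on sets of size \<open>Suc m\<close>.\<close>

definition swap_moment :: "'a set \<Rightarrow> nat \<Rightarrow> nat \<Rightarrow> ('a set \<Rightarrow> real) \<Rightarrow> real" where
  "swap_moment V m n f = (\<Sum>x\<in>V. \<Sum>y\<in>V - {x}.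
     average (nsets (V - {x, y}) m) (\<lambda>A. (f (insert x A) - f (insert y A)) ^ n))"

lemma swap_moment_nonneg: "even n \<Longrightarrow> 0 \<le> swap_moment V m n f"
  unfolding swap_moment_def by (intro sum_nonneg average_nonneg zero_le_even_power)

text \<open>Both conditional means contain the value of \<open>f\<close> at
  \<open>insert x (insert y A)\<close>, which cancels. Hence the denominator exceeds the number of
  remaining terms by one.\<close>

lemma exposure_mean_diff:
  assumes "finite V" "x \<in> V" "y \<in> V" "x \<noteq> y" "A \<subseteq> V - {x, y}"
  shows "exposure_mean V f (insert x A) - exposure_mean V f (insert y A) =
    (\<Sum>z\<in>V - {x, y} - A. f (insert x (insert z A)) - f (insert y (insert z A)))
      / (real (card (V - {x, y} - A)) + 1)"
proof -
  let ?Z = "V - {x, y} - A"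
  have V: "V - insert x A = insert y ?Z" "V - insert y A = insert x ?Z"
    using assms by auto
  have fin: "finite ?Z" using assms by auto
  have "exposure_mean V f (insert x A) =
      (f (insert y (insert x A)) + (\<Sum>z\<in>?Z. f (insert z (insert x A)))) / (real (card ?Z) + 1)"
    unfolding exposure_mean_def average_def V using fin by (simp add: add.commute)
  moreover have "exposure_mean V f (insert y A) =
      (f (insert y (insert x A)) + (\<Sum>z\<in>?Z. f (insert z (insert y A)))) / (real (card ?Z) + 1)"
    unfolding exposure_mean_def average_def V using fin by (simp add: insert_commute add.commute)
  ultimately show ?thesis
    by (simp add: diff_divide_distrib[symmetric] sum_subtractf insert_commute)
qed

text \<open>The change of the conditional mean under a swap is at most, in absolute value, an
  average of changes of \<open>f\<close> under the same swap. Jensen's inequality then gives the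
  bound, so a hypothesis on the swap moment survives each conditioning step.\<close>

lemma swap_moment_exposure_mean_le:
  assumes "finite V" "Suc m < card V" "even n" "0 < n"
  shows "swap_moment V m n (exposure_mean V f) \<le> swap_moment V (Suc m) n f"
  unfolding swap_moment_def
proof (intro sum_mono)
  fix x y assume x: "x \<in> V" and y: "y \<in> V - {x}"
  let ?W = "V - {x, y}"
  let ?g = "\<lambda>A. f (insert x A) - f (insert y A)"
  have finW: "finite ?W" using assms by simp
  have cardW: "card ?W = card V - 2"
    using x y assms by (subst card_Diff_subset) auto
  have diff: "exposure_mean V f (insert x A) - exposure_mean V f (insert y A) =
      (\<Sum>z\<in>?W - A. ?g (insert z A)) / (real (card (?W - A)) + 1)"
    if "A \<in> nsets ?W m" for A
    using that x y assms by (intro exposure_mean_diff) (auto simp: nsets_def)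
  have cardZ: "card (?W - A) = card V - 2 - m" if "A \<in> nsets ?W m" for A
    using that cardW finW by (subst card_Diff_subset) (auto simp: nsets_def)
  show "average (nsets ?W m) (\<lambda>A. (exposure_mean V f (insert x A) - exposure_mean V f (insert y A)) ^ n)
    \<le> average (nsets ?W (Suc m)) (\<lambda>A. ?g A ^ n)"
  proof (cases "m < card ?W")
    case True
    have "average (nsets ?W m)
        (\<lambda>A. (exposure_mean V f (insert x A) - exposure_mean V f (insert y A)) ^ n) \<le>
        average (nsets ?W m) (\<lambda>A. average (?W - A) (\<lambda>z. ?g (insert z A) ^ n))"
    proof (rule average_mono)
      fix A assume A: "A \<in> nsets ?W m"
      have pos: "card (?W - A) > 0"
        using cardZ[OF A] True cardW by simp
      \<comment> \<open>Lowering the denominator from \<open>card (?W - A) + 1\<close> to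
        \<open>card (?W - A)\<close> only enlarges the absolute value.\<close>
      have "\<bar>exposure_mean V f (insert x A) - exposure_mean V f (insert y A)\<bar>
          \<le> \<bar>average (?W - A) (\<lambda>z. ?g (insert z A))\<bar>"
        unfolding diff[OF A] average_def abs_divide using pos
        by (intro divide_left_mono) auto
      then have "(exposure_mean V f (insert x A) - exposure_mean V f (insert y A)) ^ n
          \<le> average (?W - A) (\<lambda>z. ?g (insert z A)) ^ n"
        using assms(3) by (intro power_mono_even)
      also have "\<dots> \<le> average (?W - A) (\<lambda>z. ?g (insert z A) ^ n)"
        using pos assms(3) by (intro average_power_le) (auto simp: card_gt_0_iff)
      finally show "(exposure_mean V f (insert x A) - exposure_mean V f (insert y A)) ^ n
          \<le> average (?W - A) (\<lambda>z. ?g (insert z A) ^ n)" .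
    qed
    also have "\<dots> = average (nsets ?W (Suc m)) (\<lambda>A. ?g A ^ n)"
      using average_nsets_Suc[OF finW True, of "\<lambda>A. ?g A ^ n"] by simp
    finally show ?thesis .
  next
    case False
    \<comment> \<open>In this boundary case \<open>A\<close> is all of \<open>?W\<close>, no further
      \<open>z\<close> remains, and the two conditional means coincide.\<close>
    then have "card V = Suc (Suc m)"
      using cardW assms by simp
    then have Z: "?W - A = {}" if "A \<in> nsets ?W m" for A
      using cardZ[OF that] finW by simp
    have "average (nsets ?W m)
        (\<lambda>A. (exposure_mean V f (insert x A) - exposure_mean V f (insert y A)) ^ n) =
        average (nsets ?W m) (\<lambda>A. 0)"
      using assms(4) by (intro average_cong) (simp add: diff Z)
    also have "\<dots> \<le> average (nsets ?W (Suc m)) (\<lambda>A. ?g A ^ n)"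
      using assms(3) by (auto simp: average_def intro!: divide_nonneg_nonneg sum_nonneg)
    finally show ?thesis .
  qed
qed

text \<open>The left side draws \<open>x\<close> and \<open>y\<close> with replacement, but the
  diagonal contributes 0. Regrouping by pairs leaves a binomial comparison whose only loss is
  \<open>N - 1 - m \<le> N - m\<close>, where \<open>N\<close> is \<open>card V\<close>.\<close>

lemma average_pairs_le_swap_moment:
  assumes "finite V" "m < card V" "even n" "0 < n"
  shows "average (nsets V m) (\<lambda>A. average (V - A) (\<lambda>x. average (V - A)
      (\<lambda>y. (f (insert x A) - f (insert y A)) ^ n)))
    \<le> swap_moment V m n f / (real (card V) * real (card V - 1))"
proof -
  let ?N = "card V"
  let ?g = "\<lambda>A x y. (f (insert x A) - f (insert y A)) ^ n"
  have card_diff: "card (V - A) = ?N - m" if "A \<in> nsets V m" for A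
    using that assms by (auto simp: nsets_def card_Diff_subset)
  have sum_pairs: "(\<Sum>y\<in>V - A. ?g A x y) = (\<Sum>y\<in>V - A - {x}. ?g A x y)" if "x \<in> V - A" for A x
    using that assms by (subst sum.remove[of "V - A" x]) auto
  have "average (nsets V m) (\<lambda>A. average (V - A) (\<lambda>x. average (V - A) (?g A x))) =
     (\<Sum>A\<in>nsets V m. (\<Sum>x\<in>V - A. (\<Sum>y\<in>V - A - {x}. ?g A x y) / real (?N - m)) / real (?N - m))
       / real (?N choose m)"
  proof -
    have "average (V - A) (\<lambda>x. average (V - A) (?g A x)) =
        (\<Sum>x\<in>V - A. (\<Sum>y\<in>V - A - {x}. ?g A x y) / real (?N - m)) / real (?N - m)"
      if "A \<in> nsets V m" for A
      unfolding average_def card_diff[OF that] by (simp only: sum_pairs cong: sum.cong)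
    then show ?thesis
      unfolding average_def[of "nsets V m"] by simp
  qed
  also have "\<dots> = (\<Sum>A\<in>nsets V m. \<Sum>x\<in>V - A. \<Sum>y\<in>V - A - {x}. ?g A x y)
      / (real (?N - m) * real (?N - m) * real (?N choose m))"
    by (simp add: sum_divide_distrib[symmetric] mult.assoc)
  also have "(\<Sum>A\<in>nsets V m. \<Sum>x\<in>V - A. \<Sum>y\<in>V - A - {x}. ?g A x y) =
      (\<Sum>x\<in>V. \<Sum>y\<in>V - {x}. \<Sum>A\<in>nsets (V - {x, y}) m. ?g A x y)"
    using assms by (intro sum_nsets_swap_pairs)
  also have "\<dots> = (\<Sum>x\<in>V. \<Sum>y\<in>V - {x}. real (?N - 2 choose m) *
      average (nsets (V - {x, y}) m) (\<lambda>A. ?g A x y))"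
  proof (intro sum.cong refl)
    fix x y assume "x \<in> V" "y \<in> V - {x}"
    then have "card (V - {x, y}) = ?N - 2"
      using assms by (subst card_Diff_subset) auto
    then have c: "card (nsets (V - {x, y}) m) = (?N - 2 choose m)" by simp
    have fin: "finite (nsets (V - {x, y}) m)"
      using assms by (intro finite_imp_finite_nsets) auto
    show "(\<Sum>A\<in>nsets (V - {x, y}) m. ?g A x y) = real (?N - 2 choose m) *
      average (nsets (V - {x, y}) m) (\<lambda>A. ?g A x y)"
      unfolding c[symmetric] by (rule sum_eq_average[OF fin])
  qed
  also have "\<dots> = real (?N - 2 choose m) * swap_moment V m n f"
    by (simp add: swap_moment_def sum_distrib_left)
  also have "\<dots> / (real (?N - m) * real (?N - m) * real (?N choose m))
      \<le> swap_moment V m n f / (real ?N * real (?N - 1))"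
  \<comment> \<open>With a single vertex there are no pairs, so both sides are 0, the right one
    being also a division by 0.\<close>
  proof (cases "?N = 1")
    case True
    then obtain v where "V = {v}" by (auto simp: card_1_singleton_iff)
    then show ?thesis by (simp add: swap_moment_def)
  next
    case False
    then have pos: "0 < real ?N" "0 < real (?N - 1)" "0 < real (?N - m)" "0 < real (?N choose m)"
      using assms by auto
    have "(?N - m) * (?N choose m) = ?N * (?N - 1 choose m)"
      by (rule binomial_absorb_comp)
    moreover have "(?N - 1 - m) * (?N - 1 choose m) = (?N - 1) * (?N - 2 choose m)"
      using binomial_absorb_comp[of "?N - 1" m] by (simp add: numeral_2_eq_2)
    ultimately have "?N * (?N - 1) * (?N - 2 choose m) = (?N - 1 - m) * ((?N - m) * (?N choose m))"
      by (simp only: mult.assoc mult.left_commute[of "?N - 1 - m"])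
    also have "\<dots> \<le> (?N - m) * ((?N - m) * (?N choose m))"
      by (intro mult_right_mono) auto
    finally have "real (?N * (?N - 1) * (?N - 2 choose m)) \<le> real ((?N - m) * ((?N - m) * (?N choose m)))"
      by (rule of_nat_mono)
    then have "real (?N - 2 choose m) / (real (?N - m) * real (?N - m) * real (?N choose m))
       \<le> 1 / (real ?N * real (?N - 1))"
      using pos by (simp add: divide_simps mult_ac)
    from mult_right_mono[OF this swap_moment_nonneg[OF assms(3)]] show ?thesis by simp
  qed
  finally show ?thesis .
qed

text \<open>Induction on the number of exposed elements: the symmetrised inequality handles the last
  one, and the induction hypothesis is applied to \<open>exposure_mean V f\<close>, which has the
  same mean as \<open>f\<close> and no larger swap moment.\<close>

lemma average_power_nsets_le:
  assumes "finite V" "m \<le> card V" "0 < q" "0 < M"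
    and "0 \<le> w" and "0 < m \<Longrightarrow> swap_moment V (m - 1) (2 * q) f \<le> real (card V) * real (card V - 1) * w"
  defines "\<alpha> \<equiv> (1 + 1 / real M) ^ q" and "\<beta> \<equiv> (real M + 1) ^ (q - 1) * (4 * real q) ^ q"
  shows "average (nsets V m) (\<lambda>B. f B ^ (2 * q)) \<le>
    \<alpha> ^ m * (average (nsets V m) f ^ (2 * q) + real m * \<beta> * w)"
  using assms(2,6)
proof (induction m arbitrary: f)
  case 0
  show ?case by (simp add: average_def)
next
  case (Suc m)
  have m: "m < card V" using Suc.prems by simp
  have \<alpha>: "1 \<le> \<alpha>" and \<beta>: "0 \<le> \<beta>"
    using assms(4) by (auto simp: \<alpha>_def \<beta>_def intro!: one_le_power)
  let ?T = "exposure_mean V f"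
  have fin: "finite (V - A)" "V - A \<noteq> {}" if "A \<in> nsets V m" for A
    using that m assms(1) card_mono[of A V] by (auto simp: nsets_def)
  have IH: "average (nsets V m) (\<lambda>A. ?T A ^ (2 * q)) \<le>
      \<alpha> ^ m * (average (nsets V m) ?T ^ (2 * q) + real m * \<beta> * w)"
  proof (rule Suc.IH)
    assume "0 < m"
    then obtain l where l: "m = Suc l" by (cases m) auto
    have "swap_moment V l (2 * q) ?T \<le> swap_moment V m (2 * q) f"
      unfolding l using m l assms(1,3) by (intro swap_moment_exposure_mean_le) auto
    then show "swap_moment V (m - 1) (2 * q) ?T \<le> real (card V) * real (card V - 1) * w"
      using Suc.prems(2) l by simp
  qed (use m in simp)
  have w: "swap_moment V m (2 * q) f / (real (card V) * real (card V - 1)) \<le> w"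
  proof (cases "real (card V) * real (card V - 1) = 0")
    case True
    then show ?thesis using assms(5) by (simp only: division_ring_divide_zero)
  next
    case False
    then have pos: "0 < real (card V) * real (card V - 1)"
      by (metis less_eq_real_def mult_nonneg_nonneg of_nat_0_le_iff)
    have "swap_moment V m (2 * q) f \<le> real (card V) * real (card V - 1) * w"
      using Suc.prems(2) by simp
    then show ?thesis
      unfolding pos_divide_le_eq[OF pos] by (simp only: mult.commute)
  qed
  have "average (nsets V (Suc m)) (\<lambda>B. f B ^ (2 * q)) =
      average (nsets V m) (\<lambda>A. average (V - A) (\<lambda>x. f (insert x A) ^ (2 * q)))"
    using assms(1) m by (rule average_nsets_Suc)
  also have "\<dots> \<le> average (nsets V m) (\<lambda>A. \<alpha> * ?T A ^ (2 * q) + \<beta> *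
      average (V - A) (\<lambda>x. average (V - A) (\<lambda>y. (f (insert x A) - f (insert y A)) ^ (2 * q))))"
    unfolding \<alpha>_def \<beta>_def exposure_mean_def
    by (intro average_mono average_power_le_symmetrized fin assms(3,4))
  also have "\<dots> = \<alpha> * average (nsets V m) (\<lambda>A. ?T A ^ (2 * q)) + \<beta> * average (nsets V m) (\<lambda>A.
      average (V - A) (\<lambda>x. average (V - A) (\<lambda>y. (f (insert x A) - f (insert y A)) ^ (2 * q))))"
    by (simp only: average_add average_cmult)
  also have "\<dots> \<le> \<alpha> * (\<alpha> ^ m * (average (nsets V m) ?T ^ (2 * q) + real m * \<beta> * w)) + \<beta> * w"
  proof (intro add_mono mult_left_mono IH)
    show "average (nsets V m) (\<lambda>A. average (V - A) (\<lambda>x. average (V - A)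
        (\<lambda>y. (f (insert x A) - f (insert y A)) ^ (2 * q)))) \<le> w"
      using average_pairs_le_swap_moment[OF assms(1) m, of "2 * q" f] w assms(3) by simp
  qed (use \<alpha> \<beta> in auto)
  \<comment> \<open>The new error term is inflated by \<open>\<alpha> ^ Suc m\<close>, which is at
    least 1, to keep the closed form.\<close>
  also have "\<dots> \<le> \<alpha> * (\<alpha> ^ m * (average (nsets V m) ?T ^ (2 * q) + real m * \<beta> * w)) + \<alpha> ^ Suc m * (\<beta> * w)"
  proof -
    have "1 * (\<beta> * w) \<le> \<alpha> ^ Suc m * (\<beta> * w)"
      using \<alpha> \<beta> assms(5) by (intro mult_right_mono one_le_power) auto
    then show ?thesis by simp
  qed
  also have "\<dots> = \<alpha> ^ Suc m * (average (nsets V m) ?T ^ (2 * q) + real (Suc m) * \<beta> * w)"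
    by (simp add: algebra_simps)
  also have "average (nsets V m) ?T = average (nsets V (Suc m)) f"
    unfolding exposure_mean_def using average_nsets_Suc[OF assms(1) m] by simp
  finally show ?case .
qed

text \<open>The constant is \<open>24 = 3 * 2 * 4\<close>: 3 bounds \<open>exp 1\<close>, 2 comes
  from \<open>M + 1 \<le> 2 * M\<close>, and 4 from the two-point inequality. Keeping
  \<open>M\<close> separate from \<open>m\<close> gives the same constant for the smaller sets met
  in the recursion on links.\<close>

lemma centered_moment_nsets_le:
  assumes "finite V" "m \<le> card V" "m \<le> M" "0 < q" "0 < M" "0 \<le> w"
    and "average (nsets V m) f = 0"
    and "0 < m \<Longrightarrow> swap_moment V (m - 1) (2 * q) f \<le> real (card V) * real (card V - 1) * w"
  shows "average (nsets V m) (\<lambda>B. f B ^ (2 * q)) \<le> (24 * real q * real M) ^ q * w"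
proof -
  let ?\<alpha> = "(1 + 1 / real M) ^ q" and ?\<beta> = "(real M + 1) ^ (q - 1) * (4 * real q) ^ q"
  have "average (nsets V m) (\<lambda>B. f B ^ (2 * q)) \<le> ?\<alpha> ^ m * (real m * ?\<beta> * w)"
  proof -
    have "(0::real) ^ (2 * q) = 0" using assms(4) by simp
    with average_power_nsets_le[OF assms(1,2,4,5,6,8)] assms(7) show ?thesis
      by (simp only: add_0)
  qed
  also have "\<dots> \<le> 3 ^ q * ((2 * real M) ^ q * (4 * real q) ^ q * w)"
  proof (rule mult_mono)
    have "(1 + 1 / real M) ^ m \<le> (1 + 1 / real M) ^ M"
      using assms by (intro power_increasing) auto
    also have "\<dots> \<le> exp (1 / real M) ^ M"
      by (intro power_mono exp_ge_add_one_self) auto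
    also have "\<dots> = exp 1"
      using assms by (simp add: exp_of_nat_mult[symmetric])
    also have "\<dots> \<le> 3" by (rule exp_le)
    finally have "((1 + 1 / real M) ^ m) ^ q \<le> 3 ^ q"
      by (intro power_mono) auto
    then show "?\<alpha> ^ m \<le> 3 ^ q"
      by (simp only: power_mult[symmetric] mult.commute)
    have "real m * (real M + 1) ^ (q - 1) \<le> (2 * real M) * (2 * real M) ^ (q - 1)"
      using assms by (intro mult_mono power_mono) auto
    also have "\<dots> = (2 * real M) ^ q"
      using assms by (cases q) auto
    finally have "real m * ?\<beta> \<le> (2 * real M) ^ q * (4 * real q) ^ q"
      unfolding mult.assoc[symmetric] by (intro mult_right_mono) auto
    then show "real m * ?\<beta> * w \<le> (2 * real M) ^ q * (4 * real q) ^ q * w"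
      using assms(6) by (rule mult_right_mono)
  qed (use assms in auto)
  also have "\<dots> = (3 * ((2 * real M) * (4 * real q))) ^ q * w"
    by (simp only: power_mult_distrib mult.assoc)
  also have "3 * ((2 * real M) * (4 * real q)) = 24 * real q * real M"
    by simp
  finally show ?thesis .
qed

subsection \<open>Degrees, links and edge counts\<close>

lemma card_nsets_supersets:
  assumes "finite V" "S \<in> nsets V j" "j \<le> i"
  shows "card {T \<in> nsets V i. S \<subseteq> T} = (card V - j choose (i - j))"
proof -
  have S: "S \<subseteq> V" "finite S" "card S = j"
    using assms by (auto simp: nsets_def)
  have "bij_betw (\<lambda>T. T - S) {T \<in> nsets V i. S \<subseteq> T} (nsets (V - S) (i - j))"
  proof (rule bij_betw_byWitness[where f' = "\<lambda>R. R \<union> S"])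
    show "(\<lambda>R. R \<union> S) ` nsets (V - S) (i - j) \<subseteq> {T \<in> nsets V i. S \<subseteq> T}"
    proof safe
      fix R assume R: "R \<in> nsets (V - S) (i - j)"
      then have "card (R \<union> S) = (i - j) + j"
        using S by (subst card_Un_disjoint) (auto simp: nsets_def)
      then show "R \<union> S \<in> nsets V i"
        using R S assms(3) by (auto simp: nsets_def)
    qed
  qed (use S in \<open>auto simp: nsets_def card_Diff_subset\<close>)
  then have "card {T \<in> nsets V i. S \<subseteq> T} = card (nsets (V - S) (i - j))"
    by (rule bij_betw_same_card)
  also have "\<dots> = (card V - j choose (i - j))"
    using S assms(1) by (simp add: card_Diff_subset)
  finally show ?thesis .
qed

text \<open>Double counting of the pairs \<open>(T, e)\<close> with
  \<open>S \<subseteq> T \<subseteq> e\<close>.\<close>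

lemma sum_hdeg_supersets:
  assumes "finite V" "H \<subseteq> nsets V k" "S \<in> nsets V j" "j \<le> i"
  shows "(\<Sum>T | T \<in> nsets V i \<and> S \<subseteq> T. hdeg H T) = hdeg H S * (k - j choose (i - j))"
proof -
  have finH: "finite H"
    using assms(1,2) finite_imp_finite_nsets finite_subset by blast
  have fin: "finite (nsets V i)"
    using assms(1) by (rule finite_imp_finite_nsets)
  have "(\<Sum>T | T \<in> nsets V i \<and> S \<subseteq> T. hdeg H T) =
      (\<Sum>T | T \<in> nsets V i \<and> S \<subseteq> T. \<Sum>e | e \<in> H \<and> T \<subseteq> e. 1)"
    by (simp add: hdeg_def)
  also have "\<dots> = (\<Sum>e\<in>H. \<Sum>T | T \<in> {T \<in> nsets V i. S \<subseteq> T} \<and> T \<subseteq> e. 1)"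
    using sum.swap_restrict[of "{T \<in> nsets V i. S \<subseteq> T}" H "\<lambda>_ _. 1::nat" "\<lambda>T e. T \<subseteq> e"] fin finH
    by simp
  also have "\<dots> = (\<Sum>e\<in>H. if S \<subseteq> e then (k - j choose (i - j)) else 0)"
  proof (intro sum.cong refl)
    fix e assume e: "e \<in> H"
    then have e': "e \<subseteq> V" "finite e" "card e = k"
      using assms(2) by (auto simp: nsets_def)
    show "(\<Sum>T | T \<in> {T \<in> nsets V i. S \<subseteq> T} \<and> T \<subseteq> e. 1) = (if S \<subseteq> e then (k - j choose (i - j)) else 0)"
    proof (cases "S \<subseteq> e")
      case True
      then have "{T. T \<in> {T \<in> nsets V i. S \<subseteq> T} \<and> T \<subseteq> e} = {T \<in> nsets e i. S \<subseteq> T}"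
        using e' by (auto simp: nsets_def)
      moreover have "S \<in> nsets e j"
        using True assms(3) by (auto simp: nsets_def)
      ultimately show ?thesis
        using True e' card_nsets_supersets[of e S j i] assms(4) by simp
    next
      case False
      then have empty: "{T. T \<in> {T \<in> nsets V i. S \<subseteq> T} \<and> T \<subseteq> e} = {}"
        by blast
      show ?thesis
        unfolding empty using False by simp
    qed
  qed
  also have "\<dots> = hdeg H S * (k - j choose (i - j))"
    using finH by (simp add: sum.If_cases hdeg_def Int_def)
  finally show ?thesis .
qed

text \<open>Double counting of the pairs of an edge and an \<open>m\<close>-set containing it. If
  \<open>m < k\<close> no edge fits and both sides vanish.\<close>

lemma average_edge_count:
  assumes "finite V" "H \<subseteq> nsets V k" "m \<le> card V"
  shows "average (nsets V m) (\<lambda>B. real (edge_count H B)) =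
    real (card H) * (real (m choose k) / real (card V choose k))"
proof (cases "H = {} \<or> m < k")
  case True
  have "edge_count H B = 0" if B: "B \<in> nsets V m" for B
  proof -
    have "{e \<in> H. e \<subseteq> B} = {}"
    proof (rule ccontr)
      assume "{e \<in> H. e \<subseteq> B} \<noteq> {}"
      then obtain e where e: "e \<in> H" "e \<subseteq> B" by blast
      then have "card e = k" "card e \<le> card B"
        using assms(2) B by (auto simp: nsets_def intro!: card_mono)
      then show False using B True e by (auto simp: nsets_def)
    qed
    then show ?thesis by (simp only: edge_count_def card.empty)
  qed
  then have "average (nsets V m) (\<lambda>B. real (edge_count H B)) = 0"
    by (simp add: average_def)
  with True show ?thesis by auto
next
  case False
  have finH: "finite H"
    using assms(1,2) finite_imp_finite_nsets finite_subset by blast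
  have "(\<Sum>B\<in>nsets V m. edge_count H B) = (\<Sum>B\<in>nsets V m. \<Sum>e | e \<in> H \<and> e \<subseteq> B. 1)"
    by (simp add: edge_count_def)
  also have "\<dots> = (\<Sum>e\<in>H. \<Sum>B | B \<in> nsets V m \<and> e \<subseteq> B. 1)"
    using assms(1) finH by (intro sum.swap_restrict finite_imp_finite_nsets)
  also have "\<dots> = (\<Sum>e\<in>H. (card V - k choose (m - k)))"
    using assms(1,2) False by (intro sum.cong refl) (auto simp: card_nsets_supersets)
  also have "\<dots> = card H * (card V - k choose (m - k))"
    by simp
  finally have "(\<Sum>B\<in>nsets V m. real (edge_count H B)) = real (card H) * real (card V - k choose (m - k))"
    by (metis of_nat_mult of_nat_sum)
  then have avg: "average (nsets V m) (\<lambda>B. real (edge_count H B)) =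
      real (card H) * real (card V - k choose (m - k)) / real (card V choose m)"
    by (simp add: average_def)
  have "(card V choose m) * (m choose k) = (card V choose k) * (card V - k choose (m - k))"
    using False assms(3) by (intro choose_mult) auto
  then have "real (card V choose m) * real (m choose k) =
      real (card V choose k) * real (card V - k choose (m - k))"
    by (metis of_nat_mult)
  moreover have "real (card V choose m) > 0" "real (card V choose k) > 0"
    using False assms(3) by auto
  ultimately have "real (card V - k choose (m - k)) / real (card V choose m) =
      real (m choose k) / real (card V choose k)"
    by (simp add: divide_simps mult.commute)
  then show ?thesis unfolding avg by (metis times_divide_eq_right)
qed

text \<open>The ratio is a product of factors \<open>(m - i) / (N - i)\<close>, each at most
  \<open>m / N\<close>.\<close>

lemma binomial_ratio_le:
  assumes "m \<le> N"
  shows "real (m choose k) / real (N choose k) \<le> (real m / real N) ^ k"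
proof (cases "m < k")
  case True
  then show ?thesis by (simp add: binomial_eq_0)
next
  case False
  then have "k \<le> m" by simp
  then show ?thesis
  proof (induction k)
    case 0
    show ?case by simp
  next
    case (Suc k)
    have step: "real (n choose Suc k) = real (n choose k) * (real (n - k) / real (Suc k))" for n
    proof -
      have "Suc k * (n choose Suc k) = (n - k) * (n choose k)"
        using binomial_absorption[of k n] binomial_absorb_comp[of n k] by simp
      then have "real (Suc k) * real (n choose Suc k) = real (n - k) * real (n choose k)"
        by (metis of_nat_mult)
      then show ?thesis by (simp add: field_simps)
    qed
    have "real (m choose Suc k) / real (N choose Suc k) =
        real (m choose k) / real (N choose k) * (real (m - k) / real (N - k))"
      unfolding step by simp
    also have "\<dots> \<le> (real m / real N) ^ k * (real m / real N)"
    proof (rule mult_mono)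
      show "real (m choose k) / real (N choose k) \<le> (real m / real N) ^ k"
        using Suc by simp
      have "real (m - k) * real N \<le> real m * real (N - k)"
        using Suc.prems assms mult_left_mono[of "real m" "real N" "real k"]
        by (simp add: of_nat_diff algebra_simps)
      then show "real (m - k) / real (N - k) \<le> real m / real N"
        using Suc.prems assms by (simp add: divide_simps)
    qed auto
    finally show ?case by (simp add: mult.commute)
  qed
qed

section \<open>Links of vertices\<close>

definition link :: "nat set set \<Rightarrow> nat \<Rightarrow> nat set set" where
  "link H x = (\<lambda>e. e - {x}) ` {e \<in> H. x \<in> e}"

lemma inj_on_remove: "inj_on (\<lambda>e. e - {x}) {e. x \<in> e}"
  by (rule inj_onI) (metis insert_Diff mem_Collect_eq)

lemma link_subset_nsets: "H \<subseteq> nsets V (Suc k) \<Longrightarrow> link H x \<subseteq> nsets (V - {x}) k"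
  by (auto simp: link_def nsets_def)

lemma hdeg_link:
  assumes "x \<notin> S"
  shows "hdeg (link H x) S = hdeg H (insert x S)"
proof -
  have "{e \<in> link H x. S \<subseteq> e} = (\<lambda>e. e - {x}) ` {e \<in> H. insert x S \<subseteq> e}"
    using assms by (auto simp: link_def)
  moreover have "inj_on (\<lambda>e. e - {x}) {e \<in> H. insert x S \<subseteq> e}"
    by (rule inj_on_subset[OF inj_on_remove]) auto
  ultimately show ?thesis by (simp add: hdeg_def card_image)
qed

lemma card_link: "card (link H x) = hdeg H {x}"
  using hdeg_link[of x "{}" H] by (simp add: hdeg_def)

text \<open>Edges are split according to whether they contain \<open>x\<close>. In a swap the term
  \<open>edge_count H A\<close> cancels, leaving the difference of two link counts.\<close>

lemma edge_count_insert:
  assumes "finite H" "x \<notin> A"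
  shows "edge_count H (insert x A) = edge_count H A + edge_count (link H x) A"
proof -
  have "{e \<in> link H x. e \<subseteq> A} = (\<lambda>e. e - {x}) ` {e \<in> H. x \<in> e \<and> e \<subseteq> insert x A}"
    using assms(2) by (auto simp: link_def)
  moreover have "inj_on (\<lambda>e. e - {x}) {e \<in> H. x \<in> e \<and> e \<subseteq> insert x A}"
    by (rule inj_on_subset[OF inj_on_remove]) auto
  ultimately have "edge_count (link H x) A = card {e \<in> H. x \<in> e \<and> e \<subseteq> insert x A}"
    by (simp add: edge_count_def card_image)
  moreover have "{e \<in> H. e \<subseteq> insert x A} = {e \<in> H. e \<subseteq> A} \<union> {e \<in> H. x \<in> e \<and> e \<subseteq> insert x A}"
    by auto
  moreover have "{e \<in> H. e \<subseteq> A} \<inter> {e \<in> H. x \<in> e \<and> e \<subseteq> insert x A} = {}"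
    using assms(2) by auto
  ultimately show ?thesis
    using assms(1) by (simp add: edge_count_def card_Un_disjoint)
qed

text \<open>Jensen's inequality for three points. The factor is kept as \<open>3 ^ n / 3\<close>
  because the three summands will each be bounded by the same quantity.\<close>

lemma power_sum3_le:
  fixes a b c :: real
  assumes "even n"
  shows "(a + b + c) ^ n \<le> 3 ^ n / 3 * (a ^ n + b ^ n + c ^ n)"
proof -
  let ?f = "\<lambda>i::nat. if i = 0 then a else if i = 1 then b else c"
  have "average {0, 1, 2} ?f ^ n \<le> average {0, 1, 2} (\<lambda>i. ?f i ^ n)"
    using assms by (intro average_power_le) auto
  then have "((a + b + c) / 3) ^ n \<le> (a ^ n + b ^ n + c ^ n) / 3"
    by (simp add: average_def add.assoc)
  then show ?thesis by (simp add: power_divide field_simps)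
qed

lemma average_const_le: "0 \<le> c \<Longrightarrow> average A (\<lambda>_. c) \<le> c"
  by (cases "card A = 0") (auto simp: average_def)

text \<open>For \<open>l < card W\<close>, an \<open>l\<close>-set avoiding a uniform
  \<open>y\<close> is a uniform \<open>l\<close>-set, so equality holds. For
  \<open>l = card W\<close> the families on the left are empty while the one on the right is not,
  hence the inequality and the sign condition on \<open>h\<close>.\<close>

lemma sum_average_nsets_remove_le:
  assumes "finite W" "\<And>A. 0 \<le> h A"
  shows "(\<Sum>y\<in>W. average (nsets (W - {y}) l) h) \<le> real (card W) * average (nsets W l) h"
proof (cases "l < card W")
  case True
  let ?n = "card W"
  have c: "card (nsets (W - {y}) l) = (?n - 1 choose l)" if "y \<in> W" for y
    using that assms(1) by simp
  have pos: "real (?n - 1 choose l) > 0" using True by simp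
  have "real (?n - 1 choose l) * (\<Sum>y\<in>W. average (nsets (W - {y}) l) h) =
      (\<Sum>y\<in>W. \<Sum>A\<in>nsets (W - {y}) l. h A)"
    unfolding sum_distrib_left
  proof (intro sum.cong refl)
    fix y assume "y \<in> W"
    then show "real (?n - 1 choose l) * average (nsets (W - {y}) l) h = (\<Sum>A\<in>nsets (W - {y}) l. h A)"
      using sum_eq_average[of "nsets (W - {y}) l" h] assms(1) c finite_imp_finite_nsets[of "W - {y}" l]
      by simp
  qed
  also have "\<dots> = (\<Sum>A\<in>nsets W l. \<Sum>y\<in>W - A. h A)"
    using assms(1) by (rule sum_nsets_swap[symmetric])
  also have "\<dots> = (\<Sum>A\<in>nsets W l. real (?n - l) * h A)"
    using assms(1) by (intro sum.cong refl) (auto simp: nsets_def card_Diff_subset)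
  also have "\<dots> = real (?n - l) * (real (?n choose l) * average (nsets W l) h)"
    using sum_eq_average[of "nsets W l" h] finite_imp_finite_nsets[OF assms(1)]
    by (simp add: sum_distrib_left[symmetric])
  also have "\<dots> = real ((?n - l) * (?n choose l)) * average (nsets W l) h"
    by simp
  also have "(?n - l) * (?n choose l) = ?n * (?n - 1 choose l)"
    by (rule binomial_absorb_comp)
  finally have "real (?n - 1 choose l) * (\<Sum>y\<in>W. average (nsets (W - {y}) l) h) =
      real (?n - 1 choose l) * (real ?n * average (nsets W l) h)"
    by (simp add: mult_ac)
  then show ?thesis using pos by simp
next
  case False
  have "nsets (W - {y}) l = {}" if "y \<in> W" for y
    using card_Diff1_less[OF assms(1) that] False assms(1) by (intro nsets_eq_empty) auto
  then have "(\<Sum>y\<in>W. average (nsets (W - {y}) l) h) = 0"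
    by (simp add: average_def)
  then show ?thesis using assms(2) by (simp add: average_nonneg)
qed

subsection \<open>Moments of the deviation\<close>

lemma sum_offdiagonal_swap:
  assumes "finite V"
  shows "(\<Sum>x\<in>V. \<Sum>y\<in>V - {x}. G y x) = (\<Sum>x\<in>V. \<Sum>y\<in>V - {x}. G x y)"
proof -
  have "(\<Sum>x\<in>V. \<Sum>y\<in>V - {x}. G y x) = (\<Sum>x\<in>V. \<Sum>y | y \<in> V \<and> x \<noteq> y. G y x)"
    by (intro sum.cong refl) auto
  also have "\<dots> = (\<Sum>y\<in>V. \<Sum>x | x \<in> V \<and> x \<noteq> y. G y x)"
    using assms by (intro sum.swap_restrict)
  also have "\<dots> = (\<Sum>y\<in>V. \<Sum>x\<in>V - {y}. G y x)"
    by (intro sum.cong refl) auto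
  finally show ?thesis .
qed

text \<open>The change under a swap is the deviation of the link of \<open>x\<close>, minus that of
  the link of \<open>y\<close>, plus the difference of the two link means. Each of the three parts
  contributes at most \<open>u\<close>.\<close>

lemma edge_count_swap_moment_le:
  fixes l :: nat
  assumes "finite V" "H \<subseteq> nsets V (Suc k)" "even n"
  defines "L \<equiv> \<lambda>x. average (nsets (V - {x}) l) (\<lambda>A. real (edge_count (link H x) A))"
  assumes moment: "\<And>x. x \<in> V \<Longrightarrow>
      average (nsets (V - {x}) l) (\<lambda>A. (real (edge_count (link H x) A) - L x) ^ n) \<le> u"
    and bias: "\<And>x y. x \<in> V \<Longrightarrow> y \<in> V \<Longrightarrow> (L x - L y) ^ n \<le> u"
    and "0 \<le> u"
  shows "swap_moment V l n (\<lambda>B. real (edge_count H B) - c)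
    \<le> real (card V) * real (card V - 1) * (3 ^ n * u)"
proof -
  have finH: "finite H"
    using assms(1,2) finite_imp_finite_nsets finite_subset by blast
  define D where "D = (\<lambda>x A. real (edge_count (link H x) A) - L x)"
  define G where "G = (\<lambda>x y. average (nsets (V - {x, y}) l) (\<lambda>A. D x A ^ n))"
  have pair: "average (nsets (V - {x, y}) l)
      (\<lambda>A. ((real (edge_count H (insert x A)) - c) - (real (edge_count H (insert y A)) - c)) ^ n)
      \<le> 3 ^ n / 3 * (G x y + G y x + u)"
    if x: "x \<in> V" and y: "y \<in> V - {x}" for x y
  proof -
    have "average (nsets (V - {x, y}) l)
        (\<lambda>A. ((real (edge_count H (insert x A)) - c) - (real (edge_count H (insert y A)) - c)) ^ n)
      \<le> average (nsets (V - {x, y}) l) (\<lambda>A. 3 ^ n / 3 * (D x A ^ n + D y A ^ n + u))"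
    proof (rule average_mono)
      fix A assume "A \<in> nsets (V - {x, y}) l"
      then have "x \<notin> A" "y \<notin> A" by (auto simp: nsets_def)
      then have "(real (edge_count H (insert x A)) - c) - (real (edge_count H (insert y A)) - c) =
          D x A + (- D y A) + (L x - L y)"
        using finH by (simp add: edge_count_insert D_def)
      then have "((real (edge_count H (insert x A)) - c) - (real (edge_count H (insert y A)) - c)) ^ n
          \<le> 3 ^ n / 3 * (D x A ^ n + (- D y A) ^ n + (L x - L y) ^ n)"
        using power_sum3_le[OF assms(3)] by presburger
      also have "\<dots> \<le> 3 ^ n / 3 * (D x A ^ n + D y A ^ n + u)"
        using bias[of x y] x y assms(3) by (intro mult_left_mono add_mono) auto
      finally show "((real (edge_count H (insert x A)) - c) - (real (edge_count H (insert y A)) - c)) ^ n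
          \<le> 3 ^ n / 3 * (D x A ^ n + D y A ^ n + u)" .
    qed
    also have "\<dots> = 3 ^ n / 3 * (G x y + G y x + average (nsets (V - {x, y}) l) (\<lambda>_. u))"
      unfolding G_def average_cmult average_add by (simp only: insert_commute)
    also have "\<dots> \<le> 3 ^ n / 3 * (G x y + G y x + u)"
      using average_const_le[OF assms(7)] by (intro mult_left_mono add_left_mono) auto
    finally show ?thesis .
  qed
  \<comment> \<open>In \<open>G\<close> the set avoids \<open>y\<close> as well as \<open>x\<close>;
    summing over \<open>y\<close> reduces this to the hypothesis about sets avoiding
    \<open>x\<close> only.\<close>
  have "(\<Sum>x\<in>V. \<Sum>y\<in>V - {x}. G x y) \<le> (\<Sum>x\<in>V. real (card V - 1) * u)"
  proof (rule sum_mono)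
    fix x assume x: "x \<in> V"
    have "(\<Sum>y\<in>V - {x}. G x y) = (\<Sum>y\<in>V - {x}. average (nsets (V - {x} - {y}) l) (\<lambda>A. D x A ^ n))"
      by (simp only: G_def Diff_insert2[symmetric])
    also have "\<dots> \<le> real (card (V - {x})) * average (nsets (V - {x}) l) (\<lambda>A. D x A ^ n)"
      using assms(1,3) by (intro sum_average_nsets_remove_le zero_le_even_power) auto
    also have "\<dots> \<le> real (card (V - {x})) * u"
      using moment[OF x] by (intro mult_left_mono) (auto simp: D_def)
    also have "\<dots> = real (card V - 1) * u"
      using x assms(1) by (simp only: card_Diff_singleton)
    finally show "(\<Sum>y\<in>V - {x}. G x y) \<le> real (card V - 1) * u" .
  qed
  then have sumG: "(\<Sum>x\<in>V. \<Sum>y\<in>V - {x}. G x y) \<le> real (card V) * (real (card V - 1) * u)"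
    by (simp only: sum_constant)
  have sumu: "(\<Sum>x\<in>V. \<Sum>y\<in>V - {x}. u) = real (card V) * (real (card V - 1) * u)"
  proof -
    have "(\<Sum>x\<in>V. \<Sum>y\<in>V - {x}. u) = (\<Sum>x\<in>V. real (card V - 1) * u)"
      using assms(1) by (intro sum.cong refl) (simp only: sum_constant card_Diff_singleton)
    then show ?thesis by (simp only: sum_constant)
  qed
  have "swap_moment V l n (\<lambda>B. real (edge_count H B) - c)
      \<le> (\<Sum>x\<in>V. \<Sum>y\<in>V - {x}. 3 ^ n / 3 * (G x y + G y x + u))"
    unfolding swap_moment_def by (intro sum_mono pair)
  also have "\<dots> = 3 ^ n / 3 * ((\<Sum>x\<in>V. \<Sum>y\<in>V - {x}. G x y) + (\<Sum>x\<in>V. \<Sum>y\<in>V - {x}. G y x)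
      + (\<Sum>x\<in>V. \<Sum>y\<in>V - {x}. u))"
    by (simp only: sum_distrib_left[symmetric] sum.distrib)
  also have "\<dots> = 3 ^ n / 3 * (2 * (\<Sum>x\<in>V. \<Sum>y\<in>V - {x}. G x y)
      + real (card V) * (real (card V - 1) * u))"
    unfolding sumu sum_offdiagonal_swap[OF assms(1), of G] by simp
  also have "\<dots> \<le> 3 ^ n / 3 * (2 * (real (card V) * (real (card V - 1) * u))
      + real (card V) * (real (card V - 1) * u))"
    by (intro mult_left_mono add_right_mono sumG) auto
  also have "\<dots> = real (card V) * real (card V - 1) * (3 ^ n * u)"
    by (simp add: algebra_simps)
  finally show ?thesis .
qed

text \<open>Induction on \<open>r\<close> through the links. Each level divides the target
  \<open>U\<close> by \<open>s\<close>, where \<open>216 = 24 * 3\<^sup>2\<close> absorbs the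
  constants of the moment bound and of the three-term split. Thus \<open>\<delta> j\<close> must fit
  the target left after \<open>j\<close> levels, and \<open>\<Delta>\<close> the target left after
  \<open>r\<close> levels.\<close>

lemma deviation_moment_le:
  assumes "finite V" "H \<subseteq> nsets V k" "r \<le> k" "m \<le> card V" "m \<le> M" "0 < q" "0 < M"
    and "0 \<le> \<theta>" "\<theta> \<le> 1" "real m \<le> \<theta> * real (card V)"
    and "\<And>S. S \<in> nsets V r \<Longrightarrow> real (hdeg H S) \<le> \<Delta>"
    and "\<And>j S T. 1 \<le> j \<Longrightarrow> j \<le> r \<Longrightarrow> S \<in> nsets V j \<Longrightarrow> T \<in> nsets V j \<Longrightarrow>
      \<bar>real (hdeg H S) - real (hdeg H T)\<bar> \<le> \<delta> j"
  defines "s \<equiv> sqrt (216 * real q * real M)"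
  assumes "s ^ r * \<Delta> \<le> U" and "\<And>j. 1 \<le> j \<Longrightarrow> j \<le> r \<Longrightarrow> s ^ j * \<delta> j * \<theta> ^ (k - j) \<le> U"
  shows "average (nsets V m) (\<lambda>B. (real (edge_count H B)
      - average (nsets V m) (\<lambda>B. real (edge_count H B))) ^ (2 * q)) \<le> U ^ (2 * q)"
  using assms(1-5,10-12,14-)
proof (induction r arbitrary: V H k m \<delta> U)
  case 0
  let ?L = "average (nsets V m) (\<lambda>B. real (edge_count H B))"
  have finH: "finite H"
    using "0.prems"(1,2) finite_imp_finite_nsets finite_subset by blast
  have ne: "finite (nsets V m)" "nsets V m \<noteq> {}"
    using "0.prems" by (auto simp: finite_imp_finite_nsets nsets_eq_empty_iff)
  \<comment> \<open>At depth 0 the degree bound limits the total number of edges, and edge count and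
    mean both lie between 0 and that number.\<close>
  have "hdeg H {} = card H" by (simp add: hdeg_def)
  moreover have "{} \<in> nsets V 0" by (simp add: nsets_def)
  ultimately have U: "real (card H) \<le> U" using "0.prems"(7)[of "{}"] "0.prems"(9) by simp
  have ec: "real (edge_count H B) \<le> real (card H)" for B
    using finH by (auto simp: edge_count_def intro!: card_mono)
  have "?L \<le> average (nsets V m) (\<lambda>B. real (card H))"
    by (intro average_mono ec)
  then have L: "?L \<le> real (card H)" "0 \<le> ?L"
    using ne by (auto simp: average_const intro!: average_nonneg)
  have "(real (edge_count H B) - ?L) ^ (2 * q) \<le> U ^ (2 * q)" for B
  proof (rule power_mono_even)
    show "\<bar>real (edge_count H B) - ?L\<bar> \<le> \<bar>U\<bar>"
      using ec[of B] L U by linarith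
  qed simp
  then have "average (nsets V m) (\<lambda>B. (real (edge_count H B) - ?L) ^ (2 * q))
      \<le> average (nsets V m) (\<lambda>B. U ^ (2 * q))"
    by (intro average_mono)
  then show ?case using ne by (simp only: average_const not_False_eq_True)
next
  case (Suc r)
  note IH = Suc.IH and prems = Suc.prems
  let ?L = "average (nsets V m) (\<lambda>B. real (edge_count H B))"
  let ?f = "\<lambda>B. real (edge_count H B) - ?L"
  obtain k' where k: "k = Suc k'" using prems(3) by (cases k) auto
  have s: "0 < s" using assms(6,7) by (simp add: s_def)
  have s2: "s\<^sup>2 = 216 * real q * real M" by (simp add: s_def)
  define U' where "U' = U / s"
  have ne: "finite (nsets V m)" "nsets V m \<noteq> {}"
    using prems by (auto simp: finite_imp_finite_nsets nsets_eq_empty_iff)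
  have "average (nsets V m) (\<lambda>B. ?f B ^ (2 * q)) \<le> (24 * real q * real M) ^ q * (3 ^ (2 * q) * U' ^ (2 * q))"
  proof (rule centered_moment_nsets_le)
    show "average (nsets V m) ?f = 0"
      using ne by (simp add: average_diff average_const)
    assume "0 < m"
    then obtain l where l: "m = Suc l" by (cases m) auto
    let ?Lx = "\<lambda>x. average (nsets (V - {x}) l) (\<lambda>A. real (edge_count (link H x) A))"
    have "1 \<le> real (card V)" using prems(4) l by linarith
    \<comment> \<open>The density bound passes to the link because \<open>\<theta> \<le> 1\<close>:
      the left side drops by 1, the right side by at most 1.\<close>
    then have \<theta>: "real l \<le> \<theta> * (real (card V) - 1)"
      using prems(6) l assms(9) by (simp add: algebra_simps)
    have card_V: "real (card V - 1) = real (card V) - 1" using prems(4) l by simp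
    have "swap_moment V l (2 * q) ?f \<le> real (card V) * real (card V - 1) * (3 ^ (2 * q) * U' ^ (2 * q))"
    proof (rule edge_count_swap_moment_le)
      show "finite V" "H \<subseteq> nsets V (Suc k')" "even (2 * q)" "0 \<le> U' ^ (2 * q)"
        using prems k l by auto
    next
      fix x assume x: "x \<in> V"
      have ins: "insert x S \<in> nsets V (Suc j)" if "S \<in> nsets (V - {x}) j" for S j
        using that x by (auto simp: nsets_def card_insert_if)
      have hl: "hdeg (link H x) S = hdeg H (insert x S)" if "S \<in> nsets (V - {x}) j" for S j
        using that by (intro hdeg_link) (auto simp: nsets_def)
      show "average (nsets (V - {x}) l) (\<lambda>A. (real (edge_count (link H x) A) - ?Lx x) ^ (2 * q)) \<le> U' ^ (2 * q)"
      \<comment> \<open>A \<open>j\<close>-set in the link has the degree of a set of size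
        \<open>Suc j\<close> in \<open>H\<close>, so the sequence of bounds is shifted;
        \<open>k' - j\<close> equals \<open>k - Suc j\<close>.\<close>
      proof (rule IH[where k = k' and \<delta> = "\<lambda>j. \<delta> (Suc j)"])
        show "finite (V - {x})" using prems(1) by simp
        show "link H x \<subseteq> nsets (V - {x}) k'" using prems(2) k by (intro link_subset_nsets) simp
        show "r \<le> k'" using prems(3) k by simp
        show "l \<le> card (V - {x})" using prems(1,4) l x by simp
        show "l \<le> M" using prems(5) l by simp
        show "real l \<le> \<theta> * real (card (V - {x}))" using \<theta> card_V x prems(1) by simp
        show "real (hdeg (link H x) S) \<le> \<Delta>" if "S \<in> nsets (V - {x}) r" for S
          using prems(7)[OF ins[OF that]] hl[OF that] by simp
        show "\<bar>real (hdeg (link H x) S) - real (hdeg (link H x) T)\<bar> \<le> \<delta> (Suc j)"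
          if "1 \<le> j" "j \<le> r" "S \<in> nsets (V - {x}) j" "T \<in> nsets (V - {x}) j" for j S T
          unfolding hl[OF that(3)] hl[OF that(4)] using that by (intro prems(8) ins) auto
        show "s ^ r * \<Delta> \<le> U'"
          using prems(9) s by (simp add: U'_def pos_le_divide_eq mult_ac)
        show "s ^ j * \<delta> (Suc j) * \<theta> ^ (k' - j) \<le> U'" if "1 \<le> j" "j \<le> r" for j
          using prems(10)[of "Suc j"] that s k by (simp add: U'_def pos_le_divide_eq mult_ac)
      qed
    next
      fix x y assume x: "x \<in> V" and y: "y \<in> V"
      \<comment> \<open>The probability that a fixed edge of a link lies in the random
        \<open>l\<close>-set; it is the same for all links, so the means differ only through the
        vertex degrees.\<close>
      let ?\<rho> = "real (l choose k') / real (card V - 1 choose k')"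
      have Lz: "?Lx z = real (hdeg H {z}) * ?\<rho>" if "z \<in> V" for z
      proof -
        have "?Lx z = real (card (link H z)) * (real (l choose k') / real (card (V - {z}) choose k'))"
          using prems k l that by (intro average_edge_count link_subset_nsets) auto
        then show ?thesis using that prems(1) by (simp only: card_link card_Diff_singleton)
      qed
      have "?\<rho> \<le> (real l / real (card V - 1)) ^ k'"
        using prems(4) l by (intro binomial_ratio_le) simp
      also have "\<dots> \<le> \<theta> ^ k'"
        using \<theta> card_V assms(8) by (intro power_mono) (auto simp: divide_simps)
      finally have \<rho>: "?\<rho> \<le> \<theta> ^ k'" .
      have "{x} \<in> nsets V 1" "{y} \<in> nsets V 1" using x y by (auto simp: nsets_def)
      then have \<delta>: "\<bar>real (hdeg H {x}) - real (hdeg H {y})\<bar> \<le> \<delta> 1"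
        by (intro prems(8)) auto
      have "?Lx x - ?Lx y = (real (hdeg H {x}) - real (hdeg H {y})) * ?\<rho>"
        unfolding Lz[OF x] Lz[OF y] left_diff_distrib ..
      then have "\<bar>?Lx x - ?Lx y\<bar> = \<bar>real (hdeg H {x}) - real (hdeg H {y})\<bar> * ?\<rho>"
        by (simp add: abs_mult)
      also have "\<dots> \<le> \<delta> 1 * \<theta> ^ k'"
        using \<delta> \<rho> by (intro mult_mono) auto
      also have "\<dots> \<le> U'"
        using prems(10)[of 1] s k by (simp add: U'_def pos_le_divide_eq mult_ac)
      finally have "\<bar>?Lx x - ?Lx y\<bar> \<le> \<bar>U'\<bar>" by linarith
      then show "(?Lx x - ?Lx y) ^ (2 * q) \<le> U' ^ (2 * q)"
        by (intro power_mono_even) auto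
    qed
    then show "swap_moment V (m - 1) (2 * q) ?f \<le> real (card V) * real (card V - 1) * (3 ^ (2 * q) * U' ^ (2 * q))"
      using l by simp
  qed (use prems assms in auto)
  also have "\<dots> = (24 * real q * real M) ^ q * ((3\<^sup>2) ^ q * (U'\<^sup>2) ^ q)"
    by (simp only: power_mult)
  also have "\<dots> = (24 * real q * real M * (3\<^sup>2 * U'\<^sup>2)) ^ q"
    by (simp only: power_mult_distrib)
  also have "24 * real q * real M * (3\<^sup>2 * U'\<^sup>2) = s\<^sup>2 * U'\<^sup>2"
    by (simp add: s2)
  also have "\<dots> = U\<^sup>2"
    using s by (simp add: U'_def power_divide)
  finally show ?case by (simp only: power_mult)
qed

subsection \<open>Near-regular hypergraphs\<close>

text \<open>Up to a common binomial factor, the degree of \<open>S\<close> is the sum of the degrees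
  of its \<open>i\<close>-element supersets. The average degrees are related by the same factor, so
  the relative error \<open>\<eta>\<close> carries over unchanged.\<close>

lemma near_regular_mono:
  assumes "uniform_hypergraph k N H" "near_regular i \<eta> k N H" "j \<le> i" "i \<le> k"
    and S: "S \<in> nsets {1..N} j"
  shows "(1 - \<eta>) * avg_degree j k N H \<le> real (hdeg H S)"
    and "real (hdeg H S) \<le> (1 + \<eta>) * avg_degree j k N H"
proof -
  have H: "H \<subseteq> nsets {1..N} k"
    using assms(1) by (simp add: uniform_hypergraph_def)
  have "(1 - \<eta>) * avg_degree j k N H \<le> real (hdeg H S) \<and>
      real (hdeg H S) \<le> (1 + \<eta>) * avg_degree j k N H"
  proof (cases "N < k")
    case True
    then have "nsets {1..N} k = {}" by (intro nsets_eq_empty) auto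
    then have "H = {}" using H by simp
    then show ?thesis by (simp add: avg_degree_def hdeg_def)
  next
    case False
    let ?P = "{T. T \<in> nsets {1..N} i \<and> S \<subseteq> T}"
    have cardP: "card ?P = (N - j choose (i - j))"
      using card_nsets_supersets[OF _ S assms(3)] by simp
    have pos: "0 < real (N choose i)" "0 < real (N choose j)" "0 < real (k - j choose (i - j))"
        "0 < real (i choose j)"
      using False assms(3,4) by (auto simp: diff_le_mono)
    have "(N choose i) * (i choose j) = (N choose j) * (N - j choose (i - j))"
      using False assms(3,4) by (intro choose_mult) auto
    then have N: "real (N choose i) * real (i choose j) = real (N choose j) * real (N - j choose (i - j))"
      by (metis of_nat_mult)
    have "(k choose i) * (i choose j) = (k choose j) * (k - j choose (i - j))"
      using assms(3,4) by (intro choose_mult) auto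
    then have k: "real (k choose i) * real (i choose j) = real (k choose j) * real (k - j choose (i - j))"
      by (metis of_nat_mult)
    have "avg_degree j k N H * real (k - j choose (i - j)) =
        real (card H) * (real (k choose j) * real (k - j choose (i - j))) / real (N choose j)"
      by (simp add: avg_degree_def)
    also have "\<dots> = real (card H) * real (k choose i) * (real (i choose j) / real (N choose j))"
      by (simp add: k[symmetric])
    also have "real (i choose j) / real (N choose j) = real (N - j choose (i - j)) / real (N choose i)"
      using N pos by (simp add: divide_simps mult.commute)
    finally have avg: "avg_degree j k N H * real (k - j choose (i - j)) =
        real (N - j choose (i - j)) * avg_degree i k N H"
      by (simp add: avg_degree_def)
    have "(\<Sum>T\<in>?P. hdeg H T) = hdeg H S * (k - j choose (i - j))"
      using H S assms(3) by (intro sum_hdeg_supersets) auto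
    then have sum: "(\<Sum>T\<in>?P. real (hdeg H T)) = real (hdeg H S) * real (k - j choose (i - j))"
      by (metis of_nat_mult of_nat_sum)
    have "(\<Sum>T\<in>?P. (1 - \<eta>) * avg_degree i k N H) \<le> (\<Sum>T\<in>?P. real (hdeg H T))"
      using assms(2) by (intro sum_mono) (simp add: near_regular_def)
    moreover have "(\<Sum>T\<in>?P. real (hdeg H T)) \<le> (\<Sum>T\<in>?P. (1 + \<eta>) * avg_degree i k N H)"
      using assms(2) by (intro sum_mono) (simp add: near_regular_def)
    ultimately have "(1 - \<eta>) * (avg_degree j k N H * real (k - j choose (i - j)))
          \<le> real (hdeg H S) * real (k - j choose (i - j))"
      "real (hdeg H S) * real (k - j choose (i - j))
          \<le> (1 + \<eta>) * (avg_degree j k N H * real (k - j choose (i - j)))"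
      unfolding sum sum_constant cardP avg by (simp_all only: mult_ac)
    then show ?thesis
      using pos(3) by (simp only: mult.assoc[symmetric] mult_le_cancel_right_pos)
  qed
  then show "(1 - \<eta>) * avg_degree j k N H \<le> real (hdeg H S)"
    and "real (hdeg H S) \<le> (1 + \<eta>) * avg_degree j k N H" by auto
qed

lemma hdeg_le_max_degree: "S \<in> nsets {1..N} r \<Longrightarrow> hdeg H S \<le> max_degree r N H"
  unfolding max_degree_def
  by (intro cSUP_upper bdd_above_finite finite_imageI finite_imp_finite_nsets) auto

lemma avg_degree_le_max_degree:
  assumes "uniform_hypergraph k N H" "r \<le> N"
  shows "avg_degree r k N H \<le> real (max_degree r N H)"
proof -
  have "(\<Sum>T | T \<in> nsets {1..N} r \<and> {} \<subseteq> T. hdeg H T) = hdeg H {} * (k - 0 choose (r - 0))"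
    using assms by (intro sum_hdeg_supersets[of "{1..N}"]) (auto simp: uniform_hypergraph_def nsets_def)
  then have "card H * (k choose r) = (\<Sum>T\<in>nsets {1..N} r. hdeg H T)"
    by (simp add: hdeg_def)
  also have "\<dots> \<le> (\<Sum>T\<in>nsets {1..N} r. max_degree r N H)"
    by (intro sum_mono hdeg_le_max_degree)
  also have "\<dots> = (N choose r) * max_degree r N H" by simp
  finally have "real (card H * (k choose r)) \<le> real ((N choose r) * max_degree r N H)"
    by (rule of_nat_mono)
  moreover have "0 < real (N choose r)" using assms(2) by simp
  ultimately show ?thesis
    by (simp add: avg_degree_def pos_divide_le_eq mult.commute)
qed

lemma avg_degree_le:
  assumes "k \<le> N"
  shows "avg_degree j k N H \<le> real (card H) * (real k / real N) ^ j"
  using mult_left_mono[OF binomial_ratio_le[OF assms, of j], of "real (card H)"]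
  by (simp add: avg_degree_def)

text \<open>Lets the exponent \<open>10 ^ r\<close> in the lower bound on \<open>a\<close> supply
  the power \<open>r ^ 3 = r\<^sup>2 * r\<close>, from which an \<open>r\<close>-th root is
  taken.\<close>

lemma cube_le_ten_power: "r ^ 3 \<le> (10::nat) ^ r"
proof -
  have "r ^ 3 \<le> (2 ^ r) ^ 3"
    by (intro power_mono less_imp_le[OF less_exp]) auto
  also have "\<dots> = (2 ^ 3) ^ r"
    by (simp only: power_mult[symmetric] mult.commute)
  also have "\<dots> \<le> 10 ^ r"
    by (intro power_mono) auto
  finally show ?thesis .
qed

text \<open>Here \<open>t\<close> stands for the \<open>r\<close>-th root of \<open>a / e(H)\<close>; comparing \<open>(r - 1)\<close>-st powers
  keeps all exponents of \<open>\<eta>\<close> and \<open>\<theta>\<close> integral.\<close>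

lemma irregularity_le_power:
  fixes t \<eta> \<theta> :: real
  assumes "2 \<le> r" "r \<le> k" "1 \<le> j" "j < r" "0 \<le> \<eta>" "\<eta> \<le> 1" "0 \<le> \<theta>" "\<theta> \<le> 1" "0 \<le> t"
    and t: "(10 * fact k) ^ (10 ^ r) * (\<eta> * \<theta> ^ (k - 1)) powr (real r / (real r - 1)) \<le> t ^ r"
  shows "4 * real k ^ j * (\<eta> * \<theta> ^ (k - j)) \<le> t ^ (r - j)"
proof -
  define y where "y = \<eta> * \<theta> ^ (k - 1)"
  define G where "G = (10 * fact k :: real)"
  have y: "0 \<le> y" using assms by (simp add: y_def)
  have "(1::real) \<le> fact k" by (rule fact_ge_1)
  then have G1: "1 \<le> G" unfolding G_def by linarith
  have "real k \<le> real (fact k)"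
    using fact_ge_self[of k] by (intro of_nat_mono)
  then have Gk: "4 * real k \<le> G" by (simp add: G_def)
  have k1: "1 \<le> real k" using assms by simp
  \<comment> \<open>The power \<open>r - 1\<close> clears the fractional exponent;
    \<open>y = 0\<close> is separate since \<open>powr_realpow\<close> needs a positive
    base.\<close>
  have "(y powr (real r / (real r - 1))) ^ (r - 1) = y ^ r"
  proof (cases "y = 0")
    case True
    then show ?thesis using assms(1) by (simp add: power_0_left)
  next
    case False
    then have "(y powr (real r / (real r - 1))) ^ (r - 1) = y powr (real r / (real r - 1) * real (r - 1))"
      using powr_realpow[of "y powr (real r / (real r - 1))" "r - 1"] y
      by (simp only: powr_powr[symmetric]) simp
    also have "real r / (real r - 1) * real (r - 1) = real r"
      using assms(1) by (simp add: of_nat_diff)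
    finally show ?thesis using False y by (simp add: powr_realpow)
  qed
  moreover have "(G ^ (10 ^ r) * y powr (real r / (real r - 1))) ^ (r - 1) \<le> (t ^ r) ^ (r - 1)"
    using t G1 by (intro power_mono) (auto simp: G_def y_def)
  ultimately have "(G ^ (10 ^ r)) ^ (r - 1) * y ^ r \<le> (t ^ (r - 1)) ^ r"
    by (simp only: power_mult_distrib power_mult[symmetric] mult.commute[of r])
  moreover have "(G ^ r\<^sup>2 * y) ^ r \<le> (G ^ (10 ^ r)) ^ (r - 1) * y ^ r"
  proof -
    have "(G ^ r\<^sup>2) ^ r = G ^ (r ^ 3)"
      by (simp add: power_mult[symmetric] power2_eq_square power3_eq_cube mult.assoc)
    also have "\<dots> \<le> G ^ (10 ^ r)"
      using G1 cube_le_ten_power by (intro power_increasing) auto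
    also have "\<dots> = (G ^ (10 ^ r)) ^ 1" by simp
    also have "\<dots> \<le> (G ^ (10 ^ r)) ^ (r - 1)"
      using G1 assms(1) by (intro power_increasing one_le_power) auto
    finally show ?thesis
      using y by (simp add: power_mult_distrib mult_right_mono)
  qed
  ultimately have "(G ^ r\<^sup>2 * y) ^ r \<le> (t ^ (r - 1)) ^ r" by linarith
  \<comment> \<open>The depth 1 estimate, obtained by taking \<open>r\<close>-th roots. Its power
    \<open>r - j\<close> will yield the \<open>(r - 1)\<close>-st power of the claim at depth
    \<open>j\<close>.\<close>
  then have ty: "G ^ r\<^sup>2 * y \<le> t ^ (r - 1)"
    using assms by (subst (asm) power_mono_iff) 
       (auto simp: y G1 intro!: mult_nonneg_nonneg zero_le_power order_trans[OF _ G1])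
  have "(4 * real k ^ j * (\<eta> * \<theta> ^ (k - j))) ^ (r - 1) \<le> ((4 * real k) ^ (r - 1) * (\<eta> * \<theta> ^ (k - j))) ^ (r - 1)"
  proof -
    have "4 * real k ^ j \<le> 4 ^ (r - 1) * real k ^ (r - 1)"
    proof (rule mult_mono)
      have "(4::real) ^ 1 \<le> 4 ^ (r - 1)"
        using assms(1) by (intro power_increasing) auto
      then show "(4::real) \<le> 4 ^ (r - 1)" by simp
      show "real k ^ j \<le> real k ^ (r - 1)"
        using assms k1 by (intro power_increasing) auto
    qed auto
    then show ?thesis
      using assms by (intro power_mono mult_right_mono) (auto simp: power_mult_distrib)
  qed
  also have "\<dots> = ((4 * real k) ^ (r - 1)) ^ (r - 1) * (\<eta> ^ (r - 1) * \<theta> ^ ((k - j) * (r - 1)))"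
    by (simp only: power_mult_distrib power_mult[symmetric])
  also have "\<dots> \<le> (G ^ r\<^sup>2) ^ (r - j) * (\<eta> ^ (r - j) * \<theta> ^ ((k - 1) * (r - j)))"
  proof (intro mult_mono)
    have "((4 * real k) ^ (r - 1)) ^ (r - 1) \<le> (G ^ (r - 1)) ^ (r - 1)"
      using Gk by (intro power_mono) auto
    also have "\<dots> = G ^ ((r - 1) * (r - 1))" by (simp only: power_mult)
    also have "\<dots> \<le> G ^ r\<^sup>2"
      using G1 by (intro power_increasing) (auto simp: power2_eq_square intro: mult_mono)
    also have "\<dots> = (G ^ r\<^sup>2) ^ 1" by simp
    also have "\<dots> \<le> (G ^ r\<^sup>2) ^ (r - j)"
      using G1 assms by (intro power_increasing one_le_power) auto
    finally show "((4 * real k) ^ (r - 1)) ^ (r - 1) \<le> (G ^ r\<^sup>2) ^ (r - j)" .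
    show "\<eta> ^ (r - 1) \<le> \<eta> ^ (r - j)"
      using assms by (intro power_decreasing) auto
    obtain d where d: "r = j + d" using assms(4) less_imp_add_positive by blast
    obtain u where u: "k = r + u" using assms(2) le_Suc_ex by blast
    obtain v where v: "j = Suc v" using assms(3) by (cases j) auto
    \<comment> \<open>The two sides differ by \<open>(k - r) * (j - 1)\<close>; the substitutions
      for \<open>r\<close>, \<open>k\<close> and \<open>j\<close> remove truncated
      subtraction.\<close>
    have "(k - 1) * (r - j) \<le> (k - j) * (r - 1)"
      by (simp add: d u v algebra_simps)
    then show "\<theta> ^ ((k - j) * (r - 1)) \<le> \<theta> ^ ((k - 1) * (r - j))"
      using assms by (intro power_decreasing) auto
  qed (use assms G1 in auto)
  also have "\<dots> = (G ^ r\<^sup>2 * y) ^ (r - j)"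
    by (simp only: y_def power_mult_distrib power_mult)
  also have "\<dots> \<le> (t ^ (r - 1)) ^ (r - j)"
    using ty y G1 by (intro power_mono) auto
  also have "\<dots> = (t ^ (r - j)) ^ (r - 1)"
    by (simp only: power_mult[symmetric] mult.commute)
  finally show ?thesis
    using assms by (subst (asm) power_mono_iff) auto
qed

section \<open>From the tail probability to moments\<close>

lemma mean_edge_count_eq_average:
  "m \<le> N \<Longrightarrow> mean_edge_count N H m = average (nsets {1..N} m) (\<lambda>B. real (edge_count H B))"
  unfolding mean_edge_count_def random_subset_def average_def
  by (intro integral_pmf_of_set) (auto simp: nsets_eq_empty_iff finite_imp_finite_nsets)

text \<open>Markov's inequality for the \<open>2 * q\<close>-th power, written as a count because
  the distribution is uniform.\<close>

lemma prob_deviation_le_moment: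
  assumes "m \<le> N" "0 < a"
  shows "measure_pmf.prob (random_subset N m) {B. \<bar>deviation N H m B\<bar> > a}
    \<le> average (nsets {1..N} m) (\<lambda>B. deviation N H m B ^ (2 * q)) / a ^ (2 * q)"
proof -
  let ?X = "nsets {1..N} m" and ?E = "{B. \<bar>deviation N H m B\<bar> > a}"
  have fin: "finite ?X" and ne: "?X \<noteq> {}"
    using assms(1) by (auto simp: nsets_eq_empty_iff finite_imp_finite_nsets)
  have "real (card (?X \<inter> ?E)) * a ^ (2 * q) = (\<Sum>B\<in>?X \<inter> ?E. a ^ (2 * q))"
    by simp
  also have "\<dots> \<le> (\<Sum>B\<in>?X \<inter> ?E. deviation N H m B ^ (2 * q))"
    using assms(2) by (intro sum_mono power_mono_even) auto
  also have "\<dots> \<le> (\<Sum>B\<in>?X. deviation N H m B ^ (2 * q))"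
    using fin by (intro sum_mono2) auto
  finally have "real (card (?X \<inter> ?E)) * a ^ (2 * q) / real (card ?X)
      \<le> average ?X (\<lambda>B. deviation N H m B ^ (2 * q))"
    unfolding average_def by (intro divide_right_mono) auto
  then have "real (card (?X \<inter> ?E)) / real (card ?X)
      \<le> average ?X (\<lambda>B. deviation N H m B ^ (2 * q)) / a ^ (2 * q)"
    using assms(2) by (simp add: pos_le_divide_eq)
  then show ?thesis
    unfolding random_subset_def measure_pmf_of_set[OF ne fin] .
qed

text \<open>Serves the case \<open>N = 1\<close> of the theorem, where the factor
  \<open>N powr C\<close> equals 1 and gives no slack.\<close>

lemma deviation_full: "B \<in> nsets {1..N} N \<Longrightarrow> deviation N H N B = 0"
proof -
  assume B: "B \<in> nsets {1..N} N"
  have "nsets {1..N} N = {{1..N}}"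
    by (auto simp: nsets_def dest: card_subset_eq[OF finite_atLeastAtMost])
  then show ?thesis
    using B by (simp add: deviation_def mean_edge_count_eq_average average_def)
qed

text \<open>Since \<open>864 = 4 * 216\<close>, the scale \<open>s\<close> of the recursion is at
  most \<open>b / 2\<close>, which brings the depth \<open>r\<close> term below
  \<open>a / 2\<close>. The target \<open>a / 2\<close> makes Markov's inequality yield
  \<open>(1 / 4) ^ q\<close>.\<close>

lemma deviation_moment_near_regular_le:
  fixes a :: real
  assumes "1 \<le> r" "r \<le> k" "0 \<le> \<eta>" "\<eta> \<le> 1" "uniform_hypergraph k N H"
    and "near_regular (r - 1) \<eta> k N H" "1 \<le> m" "m \<le> N"
    and a: "2 \<le> r \<Longrightarrow> (10 * fact k) ^ (10 ^ r) * real (card H)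
        * (\<eta> * real m ^ (k - 1) / real N ^ (k - 1)) powr (real r / (real r - 1)) \<le> a"
    and "0 < a" "0 < max_degree r N H" "0 < q" "0 \<le> b"
    and br: "b ^ r = a / real (max_degree r N H)" and qb: "864 * (real q * real m) \<le> b\<^sup>2"
  shows "average (nsets {1..N} m) (\<lambda>B. deviation N H m B ^ (2 * q)) \<le> (a / 2) ^ (2 * q)"
proof -
  let ?\<Delta> = "real (max_degree r N H)"
  define s where "s = sqrt (216 * real q * real m)"
  define \<theta> where "\<theta> = real m / real N"
  \<comment> \<open>Two degrees at depth \<open>r\<close> both lie between 0 and the maximum; at
    smaller depth both lie in the near-regularity window of width
    \<open>2 * \<eta> * avg_degree j k N H\<close>.\<close>
  define \<delta> where "\<delta> = (\<lambda>j. if j = r then ?\<Delta> else 2 * \<eta> * avg_degree j k N H)"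
  have H: "H \<subseteq> nsets {1..N} k"
    using assms(5) by (simp add: uniform_hypergraph_def)
  have \<Delta>: "0 < ?\<Delta>" using assms(11) by simp
  \<comment> \<open>A positive maximum degree forces an edge to exist, and hence
    \<open>k \<le> N\<close>.\<close>
  have "H \<noteq> {}"
  proof
    assume "H = {}"
    then have "max_degree r N H = (SUP S\<in>nsets {1..N} r. 0)"
      by (simp add: max_degree_def hdeg_def)
    also have "\<dots> = 0"
      by (cases "nsets {1..N} r = {}") auto
    finally show False using assms(11) by simp
  qed
  then have kN: "k \<le> N"
    using H nsets_eq_empty_iff[of "{1..N}" k] by fastforce
  have "finite H"
    using H finite_imp_finite_nsets finite_subset by blast
  then have e: "0 < real (card H)"
    using \<open>H \<noteq> {}\<close> by (simp add: card_gt_0_iff)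
  have N: "0 < real N" using assms(7,8) by simp
  have \<theta>: "0 \<le> \<theta>" "\<theta> \<le> 1" using assms(8) N by (auto simp: \<theta>_def)
  have s0: "0 \<le> s" by (simp add: s_def)
  have "s \<le> b / 2"
    unfolding s_def using qb assms(13)
    by (intro real_le_lsqrt) (auto simp: power_divide)
  then have sb: "s ^ j \<le> (b / 2) ^ j" for j
    using s0 by (intro power_mono)
  have s_top: "s ^ r * ?\<Delta> \<le> a / 2"
  proof -
    have "s ^ r * ?\<Delta> \<le> (b / 2) ^ r * ?\<Delta>"
      using sb by (intro mult_right_mono) auto
    also have "\<dots> = a / 2 ^ r"
      using \<Delta> by (simp add: power_divide br)
    also have "\<dots> \<le> a / 2 ^ 1"
      using assms(1,10) by (intro divide_left_mono power_increasing) auto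
    finally show ?thesis by simp
  qed
  have s_lower: "s ^ j * (2 * \<eta> * avg_degree j k N H) * \<theta> ^ (k - j) \<le> a / 2" if j: "1 \<le> j" "j < r" for j
  proof -
    define t where "t = root r (a / real (card H))"
    have r0: "0 < r" using assms(1) by simp
    have t0: "0 \<le> t" using assms(10) e by (simp add: t_def real_root_ge_zero)
    have tr: "t ^ r = a / real (card H)"
      using assms(10) e r0 by (simp add: t_def)
    \<comment> \<open>The maximum degree is at least the average, hence at least
      \<open>card H / N ^ r\<close>. This converts the scale \<open>b\<close>, defined from the
      maximum degree, into \<open>t * N\<close>, defined from the number of edges.\<close>
    have "real (card H) / real N ^ r \<le> avg_degree r k N H"
    proof -
      have "(N choose r) \<le> N ^ r" by (rule binomial_le_pow) (use kN assms(2) in auto)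
      then have "real (N choose r) \<le> real N ^ r" by (metis of_nat_mono of_nat_power)
      moreover have "0 < real (N choose r)" using kN assms(2) by simp
      moreover have "real (card H) * 1 \<le> real (card H) * real (k choose r)"
        using assms(2) by (intro mult_left_mono) (simp_all add: Suc_le_eq)
      ultimately show ?thesis
        unfolding avg_degree_def by (intro frac_le) simp_all
    qed
    also have "\<dots> \<le> ?\<Delta>"
      using assms(2,5) kN by (intro avg_degree_le_max_degree) auto
    finally have "a / ?\<Delta> \<le> a / (real (card H) / real N ^ r)"
      using e N \<Delta> assms(10) by (intro divide_left_mono) auto
    then have "b ^ r \<le> (t * real N) ^ r"
      by (simp add: br power_mult_distrib tr)
    then have bt: "b \<le> t * real N"
      using r0 t0 assms(13) by (subst (asm) power_mono_iff) auto
    have "4 * real k ^ j * (\<eta> * \<theta> ^ (k - j)) \<le> t ^ (r - j)"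
    proof (rule irregularity_le_power)
      have "(10 * fact k) ^ (10 ^ r) * (\<eta> * \<theta> ^ (k - 1)) powr (real r / (real r - 1)) * real (card H) \<le> a"
        using a j by (simp add: \<theta>_def power_divide mult_ac)
      then show "(10 * fact k) ^ (10 ^ r) * (\<eta> * \<theta> ^ (k - 1)) powr (real r / (real r - 1)) \<le> t ^ r"
        unfolding tr using e by (simp only: pos_le_divide_eq)
    qed (use j assms \<theta> t0 in auto)
    then have key: "2 * real k ^ j * (\<eta> * \<theta> ^ (k - j)) \<le> t ^ (r - j) / 2" by simp
    have "s ^ j \<le> (t * real N) ^ j"
    proof (rule power_mono)
      show "s \<le> t * real N" using \<open>s \<le> b / 2\<close> bt assms(13) by linarith
    qed (rule s0)
    \<comment> \<open>The powers of \<open>N\<close> in \<open>(t * N) ^ j\<close> and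
      \<open>(k / N) ^ j\<close> cancel; the remaining factor is what \<open>key\<close> bounds by
      \<open>t ^ (r - j) / 2\<close>.\<close>
    then have "s ^ j * (2 * \<eta> * avg_degree j k N H) * \<theta> ^ (k - j)
        \<le> (t * real N) ^ j * (2 * \<eta> * (real (card H) * (real k / real N) ^ j)) * \<theta> ^ (k - j)"
      using avg_degree_le[OF kN, of j H] \<theta> assms(3) t0 N
      by (intro mult_mono) (auto simp: avg_degree_def)
    also have "\<dots> = real (card H) * t ^ j * (2 * real k ^ j * (\<eta> * \<theta> ^ (k - j)))"
      using N by (simp add: power_mult_distrib power_divide)
    also have "\<dots> \<le> real (card H) * t ^ j * (t ^ (r - j) / 2)"
      using key t0 by (intro mult_left_mono) auto
    also have "\<dots> = real (card H) * t ^ r / 2"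
      using j by (simp add: power_add[symmetric])
    also have "\<dots> = a / 2"
      using e by (simp add: tr)
    finally show ?thesis .
  qed
  have "average (nsets {1..N} m) (\<lambda>B. (real (edge_count H B)
      - average (nsets {1..N} m) (\<lambda>B. real (edge_count H B))) ^ (2 * q)) \<le> (a / 2) ^ (2 * q)"
  proof (rule deviation_moment_le[where M = m and \<theta> = \<theta> and \<Delta> = ?\<Delta> and \<delta> = \<delta>, OF _ H assms(2)])
    show "real m \<le> \<theta> * real (card {1..N})" using N by (simp add: \<theta>_def)
    show "real (hdeg H S) \<le> ?\<Delta>" if "S \<in> nsets {1..N} r" for S
      using hdeg_le_max_degree[OF that, of H] by simp
    show "\<bar>real (hdeg H S) - real (hdeg H T)\<bar> \<le> \<delta> j"
      if j: "1 \<le> j" "j \<le> r" and S: "S \<in> nsets {1..N} j" and T: "T \<in> nsets {1..N} j" for j S T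
    proof (cases "j = r")
      case True
      then show ?thesis
        using hdeg_le_max_degree[of S N r H] hdeg_le_max_degree[of T N r H] S T
        by (simp add: \<delta>_def)
    next
      case False
      then have ji: "j \<le> r - 1" "r - 1 \<le> k" using j assms(2) by auto
      show ?thesis
        using near_regular_mono[OF assms(5,6) ji S] near_regular_mono[OF assms(5,6) ji T] False
        by (simp add: \<delta>_def abs_le_iff algebra_simps)
    qed
    show "sqrt (216 * real q * real m) ^ r * ?\<Delta> \<le> a / 2"
      using s_top by (simp add: s_def)
    show "sqrt (216 * real q * real m) ^ j * \<delta> j * \<theta> ^ (k - j) \<le> a / 2" if j: "1 \<le> j" "j \<le> r" for j
    proof (cases "j = r")
      case True
      have "s ^ r * ?\<Delta> * \<theta> ^ (k - r) \<le> s ^ r * ?\<Delta> * 1"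
        using \<theta> s0 by (intro mult_left_mono power_le_one) auto
      then show ?thesis using s_top True by (simp add: s_def \<delta>_def)
    next
      case False
      then show ?thesis using s_lower[of j] j by (simp add: s_def \<delta>_def)
    qed
  qed (use assms \<theta> in auto)
  then show ?thesis
    using assms(8) by (simp add: deviation_def mean_edge_count_eq_average)
qed

theorem theorem1p3:
  fixes k :: nat
  shows "\<exists>C > (0::real). \<exists>c > (0::real).
    \<forall>(r::nat) (\<eta>::real) (N::nat) (H :: nat set set) (m::nat) (a::real).
      1 \<le> r \<and> r \<le> k \<and> 0 \<le> \<eta> \<and> \<eta> \<le> 3 powr (- real r + 1) \<and>
      uniform_hypergraph k N H \<and> near_regular (r - 1) \<eta> k N H \<and>
      1 \<le> m \<and> m \<le> N \<and>
      (if r = 1 then a > 0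
       else a \<ge> (10 * fact k) ^ (10 ^ r) * real (card H)
                  * (\<eta> * real m ^ (k - 1) / real N ^ (k - 1)) powr (real r / (real r - 1)))
      \<longrightarrow>
      measure_pmf.prob (random_subset N m) {B. \<bar>deviation N H m B\<bar> > a}
        \<le> real N powr C *
          exp (- c * a powr (2 / real r) / (real m * real (max_degree r N H) powr (2 / real r)))"
\<comment> \<open>The value \<open>c = 1 / 864\<close> matches the condition relating
  \<open>q\<close> and \<open>b\<close> in the moment bound. \<open>C = 2\<close> suffices because
  \<open>N\<^sup>2 \<ge> exp 1\<close> for \<open>N \<ge> 2\<close>, which absorbs the loss from
  rounding the moment order down.\<close>
proof (rule exI[of _ 2], intro conjI, simp, rule exI[of _ "1/864"], intro conjI, simp,
    intro allI impI, elim conjE)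
  fix r :: nat and \<eta> :: real and N :: nat and H :: "nat set set" and m :: nat and a :: real
  assume r: "1 \<le> r" "r \<le> k" and \<eta>: "0 \<le> \<eta>" "\<eta> \<le> 3 powr (- real r + 1)"
    and H: "uniform_hypergraph k N H" "near_regular (r - 1) \<eta> k N H"
    and m: "1 \<le> m" "m \<le> N"
    and a: "if r = 1 then a > 0
       else a \<ge> (10 * fact k) ^ (10 ^ r) * real (card H)
                  * (\<eta> * real m ^ (k - 1) / real N ^ (k - 1)) powr (real r / (real r - 1))"
  let ?p = "measure_pmf.prob (random_subset N m) {B. \<bar>deviation N H m B\<bar> > a}"
  let ?\<Delta> = "max_degree r N H"
  define x where "x = a powr (2 / real r) / (real m * real ?\<Delta> powr (2 / real r)) / 864"
  have "(3::real) powr (- real r + 1) \<le> 3 powr 0"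
    using r by (intro powr_mono) auto
  then have \<eta>1: "\<eta> \<le> 1" using \<eta> by simp
  have a0: "0 \<le> a"
  proof (cases "r = 1")
    case False
    have "0 \<le> (10 * fact k) ^ (10 ^ r) * real (card H)
        * (\<eta> * real m ^ (k - 1) / real N ^ (k - 1)) powr (real r / (real r - 1))"
      by (intro mult_nonneg_nonneg) auto
    also have "\<dots> \<le> a" using a False by simp
    finally show ?thesis .
  qed (use a in simp)
  have "?p \<le> real N powr 2 * exp (- x)"
  proof (cases "N = 1")
    case True
    then have "m = N" using m by simp
    have ne: "nsets {1..N} N \<noteq> {}" and fin: "finite (nsets {1..N} N)"
      by (auto simp: nsets_eq_empty_iff finite_imp_finite_nsets)
    have empty: "nsets {1..N} N \<inter> {B. \<bar>deviation N H N B\<bar> > a} = {}"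
      using a0 by (auto simp: deviation_full simp del: One_nat_def)
    have "?p = 0"
      unfolding random_subset_def \<open>m = N\<close> measure_pmf_of_set[OF ne fin] empty by simp
    then show ?thesis by simp
  next
    case False
    then have N2: "2 \<le> real N" using m by simp
    then have "(2::real)\<^sup>2 \<le> (real N)\<^sup>2" by (intro power_mono) auto
    then have N4: "exp 1 \<le> real N powr 2"
      using exp_le N2 by (simp add: powr_numeral)
    have final: "exp (1 - x) \<le> real N powr 2 * exp (- x)"
    proof -
      have "exp (1 - x) = exp 1 * exp (- x)" by (simp add: exp_add[symmetric])
      also have "\<dots> \<le> real N powr 2 * exp (- x)"
        using N4 by (intro mult_right_mono) auto
      finally show ?thesis .
    qed
    show ?thesis
    proof (cases "x < 1")
      \<comment> \<open>For \<open>x < 1\<close> the claimed bound is at least 1, hence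
        trivial.\<close>
      case True
      have "?p \<le> 1" by simp
      also have "1 \<le> exp (1 - x)" using True by simp
      finally show ?thesis using final by linarith
    next
      case False
      \<comment> \<open>If \<open>a\<close> or the maximum degree were 0, then \<open>x\<close>
        would be 0, by division by 0 in the latter case; both are therefore positive here.\<close>
      then have "x \<noteq> 0" by auto
      then have "a \<noteq> 0" "?\<Delta> \<noteq> 0" by (auto simp: x_def)
      then have apos: "0 < a" and \<Delta>: "0 < ?\<Delta>" using a0 by linarith+
      define b where "b = (a / real ?\<Delta>) powr (1 / real r)"
      \<comment> \<open>Positive since \<open>x \<ge> 1\<close>; \<open>q \<le> x\<close> gives the
        condition on \<open>b\<^sup>2\<close>, while \<open>x < q + 1\<close> costs one factor
        \<open>exp 1\<close> at the end.\<close>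
      define q where "q = nat \<lfloor>x\<rfloor>"
      have q: "0 < q" "real q \<le> x" "x < real q + 1"
        using False by (auto simp: q_def)
      have ad: "0 < a / real ?\<Delta>" using apos \<Delta> by simp
      have b_power: "b ^ n = (a / real ?\<Delta>) powr (real n / real r)" for n
      proof -
        have "b ^ n = b powr real n"
          using apos \<Delta> by (intro powr_realpow[symmetric]) (simp add: b_def)
        then show ?thesis by (simp add: b_def powr_powr)
      qed
      have br: "b ^ r = a / real ?\<Delta>"
        unfolding b_power using r apos by simp
      have "b\<^sup>2 = (a / real ?\<Delta>) powr (2 / real r)"
        unfolding b_power by simp
      also have "\<dots> = 864 * (x * real m)"
        using apos \<Delta> m by (simp add: x_def powr_divide)
      finally have qb: "864 * (real q * real m) \<le> b\<^sup>2"
        using q(2) by (simp add: mult_right_mono)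
      have "average (nsets {1..N} m) (\<lambda>B. deviation N H m B ^ (2 * q)) \<le> (a / 2) ^ (2 * q)"
        by (rule deviation_moment_near_regular_le[OF r \<eta>(1) \<eta>1 H m _ apos \<Delta> q(1) _ br qb])
           (use a in \<open>auto simp: b_def\<close>)
      then have "?p \<le> (a / 2) ^ (2 * q) / a ^ (2 * q)"
        by (intro order_trans[OF prob_deviation_le_moment[OF m(2) apos, of H q]] divide_right_mono) simp_all
      also have "\<dots> = (1 / 4) ^ q"
        using apos by (simp add: power_divide power_mult)
      also have "\<dots> \<le> exp (- 1) ^ q"
      proof (rule power_mono)
        show "1 / 4 \<le> exp (- 1 :: real)"
          using exp_le by (simp add: exp_minus divide_simps)
      qed simp
      also have "\<dots> = exp (- real q)"
        by (simp add: exp_of_nat_mult[symmetric])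
      also have "\<dots> \<le> exp (1 - x)" using q(3) by simp
      finally show ?thesis using final by linarith
    qed
  qed
  then show "?p \<le> real N powr 2 *
      exp (- (1 / 864) * a powr (2 / real r) / (real m * real ?\<Delta> powr (2 / real r)))"
    by (simp add: x_def mult_ac)
qed

end
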